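(* Let $0<r<s$, let $(\mathcal{M},\tau)$ be a von Neumann algebra with faithful normal tracial state, let $Z\in\mathcal{M}$ be a DT-operator whose spectrum is contained in the closed annulus $A(r,s)=\{z\in\mathbb{C}:r\le|z|\le s\}$, and let $k\ge1$ be a natural number. Then $$\tau\big((Z^k)^*Z^k\big)\ge r^{2k},\qquad \tau\big((Z^{-k})^*Z^{-k}\big)\ge s^{-2k}.$$
   Context: DT-operators. Let $(\mathcal{M}_0,\tau_0)$ be a von Neumann algebra with faithful normal tracial state, $X\in\mathcal{M}_0$ a semicircular element with $\tau_0(X)=0$, $\tau_0(X^2)=1$, and $\lambda:L^\infty([0,1])\to\mathcal{M}_0$ a normal unital injective $*$-homomorphism with $\tau_0(\lambda(f))=\int_0^1 f(x)\,dx$, such that $X$ and $\lambda(L^\infty([0,1]))$ are free with respect to $\tau_0$. The quasinilpotent DT-operator $T=\mathcal{UT}(X,\lambda)$ ("upper triangular part of $X$") is the operator-norm limit, as $N\to\infty$, of $\sum_{k=1}^{2^N-1}\lambda(1_{[(k-1)/2^N,\,k/2^N]})\,X\,\lambda(1_{[k/2^N,\,1]})$ (the limit exists). For a compactly supported Borel probability measure $\mu$ on $\mathbb{C}$ and $c>0$, choose $f\in L^\infty([0,1])$ such that the push-forward of Lebesgue measure under $f$ is $\mu$; then the $*$-moments of $\lambda(f)+cT$ depend only on $\mu$ and $c$. A $\mathrm{DT}(\mu,c)$-operator is any element of a tracial von Neumann algebra having the same $*$-moments as $\lambda(f)+cT$. A DT-operator is a $\mathrm{DT}(\mu,c)$-operator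 for some such $\mu$ and $c$. *)

theory Defs
  imports
    "HOL-Analysis.Analysis"
    "HOL-Library.Complex_Order"
    "HOL-Probability.Probability_Measure"
begin

section \<open>Complex Hilbert spaces and bounded operators\<close>

text \<open>The inner product is antilinear in the first argument.\<close>

class complex_hilbert_space = banach +
  fixes scaleC :: "complex \<Rightarrow> 'a \<Rightarrow> 'a"
    and cinner :: "'a \<Rightarrow> 'a \<Rightarrow> complex"
  assumes scaleC_add_right: "scaleC c (x + y) = scaleC c x + scaleC c y"
    and scaleC_add_left: "scaleC (c + d) x = scaleC c x + scaleC d x"
    and scaleC_scaleC: "scaleC c (scaleC d x) = scaleC (c * d) x"
    and scaleC_of_real: "scaleC (complex_of_real a) x = scaleR a x"
    and cinner_commute: "cinner x y = cnj (cinner y x)"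
    and cinner_add_right: "cinner x (y + z) = cinner x y + cinner x z"
    and cinner_scaleC_right: "cinner x (scaleC c y) = c * cinner x y"
    and cinner_self: "cinner x x = complex_of_real ((norm x)\<^sup>2)"

lemma norm_scaleC: "norm (scaleC c x) = cmod c * norm (x :: 'a :: complex_hilbert_space)"
proof -
  have "complex_of_real ((norm (scaleC c x))\<^sup>2) = c * cnj (c * cinner x x)"
    by (metis cinner_self cinner_scaleC_right cinner_commute)
  also have "\<dots> = complex_of_real ((cmod c * norm x)\<^sup>2)"
    by (simp add: cinner_self complex_norm_square power_mult_distrib mult.assoc flip: of_real_power)
  finally have "(norm (scaleC c x))\<^sup>2 = (cmod c * norm x)\<^sup>2"
    by (simp only: of_real_eq_iff)
  then show ?thesis
    by (simp add: power2_eq_iff_nonneg)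
qed

text \<open>
  The type below consists of the bounded \<^emph>\<open>real\<close>-linear operators, with the operator norm; the
  elements of a von Neumann algebra are moreover required to be complex-linear.
\<close>

type_synonym 'a op = "'a \<Rightarrow>\<^sub>L 'a"

definition clinear_op :: "'a :: complex_hilbert_space op \<Rightarrow> bool" where
  "clinear_op A \<longleftrightarrow> (\<forall>c x. A (scaleC c x) = scaleC c (A x))"

lift_definition op_scale :: "complex \<Rightarrow> 'a :: complex_hilbert_space op \<Rightarrow> 'a op"
  is "\<lambda>c A x. scaleC c (A x)"
proof -
  fix c :: complex and A :: "'a \<Rightarrow> 'a"
  assume A: "bounded_linear A"
  have "bounded_linear (scaleC c :: 'a \<Rightarrow> 'a)"
    by (rule bounded_linear_intro[where K = "cmod c"])
      (simp_all add: scaleC_add_right norm_scaleC mult.commute scaleC_scaleC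
        flip: scaleC_of_real)
  from bounded_linear_compose[OF this A]
  show "bounded_linear (\<lambda>x. scaleC c (A x))" .
qed

definition adj :: "'a :: complex_hilbert_space op \<Rightarrow> 'a op" where
  "adj A = (THE B :: 'a op. \<forall>x y. cinner (B x) y = cinner x (A y))"

definition op_pow :: "'a :: complex_hilbert_space op \<Rightarrow> nat \<Rightarrow> 'a op" where
  "op_pow A n = ((\<lambda>B. A o\<^sub>L B) ^^ n) id_blinfun"

definition op_prod :: "'a :: complex_hilbert_space op list \<Rightarrow> 'a op" where
  "op_prod As = foldr (\<lambda>A B. A o\<^sub>L B) As id_blinfun"

definition op_le :: "'a :: complex_hilbert_space op \<Rightarrow> 'a op \<Rightarrow> bool" where
  "op_le A B \<longleftrightarrow> (\<forall>x. cinner x (A x) \<le> cinner x (B x))"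

definition self_adjoints :: "'a :: complex_hilbert_space op set \<Rightarrow> 'a op set" where
  "self_adjoints M = {A \<in> M. adj A = A}"

definition op_inverse :: "'a :: complex_hilbert_space op \<Rightarrow> 'a op" where
  "op_inverse A = (THE B. A o\<^sub>L B = id_blinfun \<and> B o\<^sub>L A = id_blinfun)"

definition spectrum_in :: "'a :: complex_hilbert_space op set \<Rightarrow> 'a op \<Rightarrow> complex set" where
  "spectrum_in M A =
     {z. \<not> (\<exists>B\<in>M. (A - op_scale z id_blinfun) o\<^sub>L B = id_blinfun
               \<and> B o\<^sub>L (A - op_scale z id_blinfun) = id_blinfun)}"

section \<open>Tracial von Neumann algebras\<close>

definition commutant :: "'a :: complex_hilbert_space op set \<Rightarrow> 'a op set" where
  "commutant S = {A. clinear_op A \<and> (\<forall>B\<in>S. A o\<^sub>L B = B o\<^sub>L A)}"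

definition von_neumann_algebra :: "'a :: complex_hilbert_space op set \<Rightarrow> bool" where
  "von_neumann_algebra M \<longleftrightarrow>
     (\<forall>A\<in>M. clinear_op A \<and> adj A \<in> M) \<and> commutant (commutant M) = M"

definition directed_wrt :: "('a \<Rightarrow> 'a \<Rightarrow> bool) \<Rightarrow> 'a set \<Rightarrow> bool" where
  "directed_wrt le D \<longleftrightarrow> D \<noteq> {} \<and> (\<forall>a\<in>D. \<forall>b\<in>D. \<exists>c\<in>D. le a c \<and> le b c)"

definition is_lub_in :: "('a \<Rightarrow> 'a \<Rightarrow> bool) \<Rightarrow> 'a set \<Rightarrow> 'a set \<Rightarrow> 'a \<Rightarrow> bool" where
  "is_lub_in le S D s \<longleftrightarrow>
     s \<in> S \<and> (\<forall>d\<in>D. le d s) \<and> (\<forall>u\<in>S. (\<forall>d\<in>D. le d u) \<longrightarrow> le s u)"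

text \<open>Normality: suprema of bounded increasing nets of self-adjoint elements are preserved.\<close>

definition normal_map ::
  "('a \<Rightarrow> 'a \<Rightarrow> bool) \<Rightarrow> 'a set \<Rightarrow> ('b \<Rightarrow> 'b \<Rightarrow> bool) \<Rightarrow> 'b set \<Rightarrow> ('a \<Rightarrow> 'b) \<Rightarrow> bool" where
  "normal_map leA SA leB SB \<phi> \<longleftrightarrow>
     (\<forall>D s. D \<subseteq> SA \<and> directed_wrt leA D \<and> is_lub_in leA SA D s
            \<longrightarrow> is_lub_in leB SB (\<phi> ` D) (\<phi> s))"

locale tracial_von_neumann_algebra =
  fixes M :: "'a :: complex_hilbert_space op set" and \<tau> :: "'a op \<Rightarrow> complex"
  assumes von_neumann_algebra: "von_neumann_algebra M"
    and trace_add: "A \<in> M \<Longrightarrow> B \<in> M \<Longrightarrow> \<tau> (A + B) = \<tau> A + \<tau> B"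
    and trace_scale: "A \<in> M \<Longrightarrow> \<tau> (op_scale c A) = c * \<tau> A"
    and trace_id: "\<tau> id_blinfun = 1"
    and trace_nonneg: "A \<in> M \<Longrightarrow> 0 \<le> \<tau> (adj A o\<^sub>L A)"
    and trace_commute: "A \<in> M \<Longrightarrow> B \<in> M \<Longrightarrow> \<tau> (A o\<^sub>L B) = \<tau> (B o\<^sub>L A)"
    and trace_faithful: "A \<in> M \<Longrightarrow> \<tau> (adj A o\<^sub>L A) = 0 \<Longrightarrow> A = 0"
    and trace_normal: "normal_map op_le (self_adjoints M) (\<le>) \<real> \<tau>"

section \<open>Freeness and semicircular elements\<close>

inductive_set star_alg :: "'a :: complex_hilbert_space op set \<Rightarrow> 'a op set" for S where
  star_alg_base: "A \<in> S \<Longrightarrow> A \<in> star_alg S"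
| star_alg_id: "id_blinfun \<in> star_alg S"
| star_alg_add: "A \<in> star_alg S \<Longrightarrow> B \<in> star_alg S \<Longrightarrow> A + B \<in> star_alg S"
| star_alg_scale: "A \<in> star_alg S \<Longrightarrow> op_scale c A \<in> star_alg S"
| star_alg_mult: "A \<in> star_alg S \<Longrightarrow> B \<in> star_alg S \<Longrightarrow> A o\<^sub>L B \<in> star_alg S"
| star_alg_adj: "A \<in> star_alg S \<Longrightarrow> adj A \<in> star_alg S"

definition free_family ::
  "('a :: complex_hilbert_space op \<Rightarrow> complex) \<Rightarrow> ('i \<Rightarrow> 'a op set) \<Rightarrow> bool" where
  "free_family \<tau> \<A> \<longleftrightarrow>
     (\<forall>w. w \<noteq> [] \<and> (\<forall>(i, A)\<in>set w. A \<in> \<A> i \<and> \<tau> A = 0) \<and> distinct_adj (map fst w)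
          \<longrightarrow> \<tau> (op_prod (map snd w)) = 0)"

definition free_sets ::
  "('a :: complex_hilbert_space op \<Rightarrow> complex) \<Rightarrow> 'a op set \<Rightarrow> 'a op set \<Rightarrow> bool" where
  "free_sets \<tau> S S' \<longleftrightarrow> free_family \<tau> (\<lambda>b. if b then star_alg S else star_alg S')"

text \<open>Semicircle law with centre \<open>a\<close> and radius \<open>R\<close> (variance \<open>R\<^sup>2 / 4\<close>).\<close>

definition semicircular :: "('a :: complex_hilbert_space op \<Rightarrow> complex) \<Rightarrow> 'a op \<Rightarrow> bool" where
  "semicircular \<tau> X \<longleftrightarrow> adj X = X \<and>
     (\<exists>a R. R > 0 \<and> (\<forall>n. \<tau> (op_pow X n) =
        complex_of_real (integral {a - R..a + R}
          (\<lambda>t. t ^ n * (2 / (pi * R\<^sup>2) * sqrt (R\<^sup>2 - (t - a)\<^sup>2))))))"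

section \<open>Representations of the algebra of essentially bounded functions on the unit interval\<close>

abbreviation leb01 :: "real measure" where
  "leb01 \<equiv> lebesgue_on {0..1}"

text \<open>
  Elements of \<open>L\<^sup>\<infinity>([0,1])\<close> are handled through representatives; maps out of it must therefore
  respect equality almost everywhere.
\<close>

definition Linf01 :: "(real \<Rightarrow> complex) set" where
  "Linf01 = {f \<in> borel_measurable leb01. \<exists>C. AE x in leb01. cmod (f x) \<le> C}"

definition Linf01_real :: "(real \<Rightarrow> complex) set" where
  "Linf01_real = {f \<in> Linf01. AE x in leb01. f x \<in> \<real>}"

definition AE_le01 :: "(real \<Rightarrow> complex) \<Rightarrow> (real \<Rightarrow> complex) \<Rightarrow> bool" where
  "AE_le01 f g \<longleftrightarrow> (AE x in leb01. f x \<le> g x)"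

text \<open>In \<open>rep_eq_iff\<close>, right-to-left is well-definedness on classes, left-to-right injectivity.\<close>

locale Linf01_representation = tracial_von_neumann_algebra M \<tau>
  for M :: "'a :: complex_hilbert_space op set" and \<tau> :: "'a op \<Rightarrow> complex" +
  fixes lam :: "(real \<Rightarrow> complex) \<Rightarrow> 'a op"
  assumes rep_in: "f \<in> Linf01 \<Longrightarrow> lam f \<in> M"
    and rep_eq_iff: "f \<in> Linf01 \<Longrightarrow> g \<in> Linf01 \<Longrightarrow> lam f = lam g \<longleftrightarrow> (AE x in leb01. f x = g x)"
    and rep_add: "f \<in> Linf01 \<Longrightarrow> g \<in> Linf01 \<Longrightarrow> lam (\<lambda>x. f x + g x) = lam f + lam g"
    and rep_scale: "f \<in> Linf01 \<Longrightarrow> lam (\<lambda>x. c * f x) = op_scale c (lam f)"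
    and rep_mult: "f \<in> Linf01 \<Longrightarrow> g \<in> Linf01 \<Longrightarrow> lam (\<lambda>x. f x * g x) = lam f o\<^sub>L lam g"
    and rep_cnj: "f \<in> Linf01 \<Longrightarrow> lam (\<lambda>x. cnj (f x)) = adj (lam f)"
    and rep_one: "lam (\<lambda>_. 1) = id_blinfun"
    and rep_normal: "normal_map AE_le01 Linf01_real op_le (self_adjoints M) lam"
    and rep_trace: "f \<in> Linf01 \<Longrightarrow> \<tau> (lam f) = integral\<^sup>L leb01 f"

section \<open>DT-operators\<close>

locale DT_setup = Linf01_representation M\<^sub>0 \<tau>\<^sub>0 lam
  for M\<^sub>0 :: "'a :: complex_hilbert_space op set" and \<tau>\<^sub>0 :: "'a op \<Rightarrow> complex"
    and lam :: "(real \<Rightarrow> complex) \<Rightarrow> 'a op" +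
  fixes X :: "'a op"
  assumes X_in: "X \<in> M\<^sub>0"
    and X_semicircular: "semicircular \<tau>\<^sub>0 X"
    and X_mean: "\<tau>\<^sub>0 X = 0"
    and X_variance: "\<tau>\<^sub>0 (op_pow X 2) = 1"
    and X_free: "free_sets \<tau>\<^sub>0 {X} (lam ` Linf01)"

text \<open>\<open>T\<close> is the upper triangular part of \<open>X\<close>; the limit is in operator norm.\<close>

definition is_upper_triangular_part ::
  "((real \<Rightarrow> complex) \<Rightarrow> 'a :: complex_hilbert_space op) \<Rightarrow> 'a op \<Rightarrow> 'a op \<Rightarrow> bool" where
  "is_upper_triangular_part lam X T \<longleftrightarrow>
     (\<lambda>N. \<Sum>k = 1..2 ^ N - 1 :: nat.
        lam (indicator {(real k - 1) / 2 ^ N..real k / 2 ^ N}) o\<^sub>L X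
          o\<^sub>L lam (indicator {real k / 2 ^ N..1})) \<longlonglongrightarrow> T"

text \<open>A word in \<open>Z\<close> and its adjoint, the letter \<^const>\<open>True\<close> standing for the adjoint.\<close>

definition star_word :: "'a :: complex_hilbert_space op \<Rightarrow> bool list \<Rightarrow> 'a op" where
  "star_word Z w = op_prod (map (\<lambda>b. if b then adj Z else Z) w)"

definition same_star_moments ::
  "('a :: complex_hilbert_space op \<Rightarrow> complex) \<Rightarrow> 'a op \<Rightarrow>
   ('b :: complex_hilbert_space op \<Rightarrow> complex) \<Rightarrow> 'b op \<Rightarrow> bool" where
  "same_star_moments \<tau> Z \<tau>' Z' \<longleftrightarrow> (\<forall>w. \<tau> (star_word Z w) = \<tau>' (star_word Z' w))"

definition compactly_supported_prob :: "complex measure \<Rightarrow> bool" where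
  "compactly_supported_prob \<mu> \<longleftrightarrow>
     prob_space \<mu> \<and> sets \<mu> = sets borel \<and> (\<exists>K. compact K \<and> emeasure \<mu> (- K) = 0)"

text \<open>
  The first three arguments of the next two definitions are the data \<open>\<tau>\<^sub>0\<close>, \<open>lam\<close>, \<open>X\<close> of a
  \<^locale>\<open>DT_setup\<close>.
\<close>

definition is_DT_operator_for ::
  "('b :: complex_hilbert_space op \<Rightarrow> complex) \<Rightarrow> ((real \<Rightarrow> complex) \<Rightarrow> 'b op) \<Rightarrow> 'b op \<Rightarrow>
   complex measure \<Rightarrow> real \<Rightarrow> ('a :: complex_hilbert_space op \<Rightarrow> complex) \<Rightarrow> 'a op \<Rightarrow> bool" where
  "is_DT_operator_for \<tau>\<^sub>0 lam X \<mu> c \<tau> Z \<longleftrightarrow>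
     (\<exists>f T. f \<in> Linf01 \<and> distr leb01 borel f = \<mu> \<and> is_upper_triangular_part lam X T
            \<and> same_star_moments \<tau> Z \<tau>\<^sub>0 (lam f + c *\<^sub>R T))"

definition is_DT_operator ::
  "('b :: complex_hilbert_space op \<Rightarrow> complex) \<Rightarrow> ((real \<Rightarrow> complex) \<Rightarrow> 'b op) \<Rightarrow> 'b op \<Rightarrow>
   ('a :: complex_hilbert_space op \<Rightarrow> complex) \<Rightarrow> 'a op \<Rightarrow> bool" where
  "is_DT_operator \<tau>\<^sub>0 lam X \<tau> Z \<longleftrightarrow>
     (\<exists>\<mu> c. compactly_supported_prob \<mu> \<and> c > 0 \<and> is_DT_operator_for \<tau>\<^sub>0 lam X \<mu> c \<tau> Z)"

end

theory Submission
  imports Defs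
begin

text \<open>
  For an invertible matrix \<open>A\<close> and the normalised trace \<open>\<tau>\<close> in dimension \<open>d\<close>, the inequality between
  arithmetic and geometric mean, applied to the eigenvalues of \<open>A\<^sup>* A\<close>, yields
  \<open>\<tau> (A\<^sup>* A) \<ge> \<bar>det A\<bar> ^ (2 / d)\<close>, and the right-hand side is bounded below by the square of the
  smallest modulus of an eigenvalue of \<open>A\<close>. Both assertions are this bound, for \<open>Z\<^sup>k\<close> and for the
  \<open>k\<close>-th power of the inverse of \<open>Z\<close>. In a tracial von Neumann algebra the Fuglede-Kadison
  determinant would take the place of \<open>det\<close>; the argument below keeps only the part of that theory
  which the bound uses.

  The central fact is \<open>trace_gram_ge_1\<close>: if \<open>\<parallel>A\<^sup>-\<^sup>n\<parallel> \<le> 1\<close> for some \<open>n > 0\<close>, then \<open>\<tau> (A\<^sup>* A) \<ge> 1\<close>. With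
  \<open>K j = (A\<^sup>j)\<^sup>* A\<^sup>j\<close>, every ratio \<open>inverse (K j) K (j + 1)\<close> has the trace \<open>\<tau> (A\<^sup>* A)\<close>. The functional
  \<open>K \<mapsto> \<tau> (log K)\<close> is concave with derivative \<open>H \<mapsto> \<tau> (inverse K H)\<close>, so it grows by at most
  \<open>\<tau> (A\<^sup>* A) - 1\<close> from \<open>K j\<close> to \<open>K (j + 1)\<close>; since it is \<open>0\<close> at \<open>K 0 = 1\<close> and nonnegative at
  \<open>K n \<ge> 1\<close>, this increment cannot be negative. Concavity is proved for the truncated logarithmic
  series (\<open>trace_log_series_convex\<close>), where it reduces to the convexity in \<open>i\<close> of
  \<open>\<tau> (y ^ (n - i) z ^ i)\<close> for positive \<open>y\<close> and \<open>z\<close>, and finally to the positivity of the trace on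
  \<open>W\<^sup>* W\<close>.

  The hypothesis on the spectrum enters through the spectral radius formula (\<open>power_decay\<close>): for
  \<open>\<rho> < r\<close> and \<open>\<sigma> > s\<close>, both \<open>\<rho>\<^sup>n \<parallel>Z\<^sup>-\<^sup>n\<parallel>\<close> and \<open>\<sigma>\<^sup>-\<^sup>n \<parallel>Z\<^sup>n\<parallel>\<close> tend to \<open>0\<close>. Hence the central fact
  applies to \<open>(Z / \<rho>)\<^sup>k\<close> and to the \<open>k\<close>-th power of \<open>\<sigma>\<close> times the inverse of \<open>Z\<close>, and the two bounds
  follow as \<open>\<rho>\<close> tends to \<open>r\<close> and \<open>\<sigma>\<close> to \<open>s\<close>.
\<close>

section \<open>Adjoints in complex Hilbert spaces\<close>

lemma cinner_add_left:
  "cinner (x + y) z = cinner x z + cinner (y :: 'a :: complex_hilbert_space) z"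
  by (metis cinner_commute cinner_add_right complex_cnj_add)

lemma cinner_scaleC_left:
  "cinner (scaleC c x) y = cnj c * cinner x (y :: 'a :: complex_hilbert_space)"
  by (metis cinner_commute cinner_scaleC_right complex_cnj_mult)

lemma cinner_scaleR_right:
  "cinner x (a *\<^sub>R y) = complex_of_real a * cinner x (y :: 'a :: complex_hilbert_space)"
  by (metis cinner_scaleC_right scaleC_of_real)

lemma cinner_scaleR_left:
  "cinner (a *\<^sub>R x) y = complex_of_real a * cinner x (y :: 'a :: complex_hilbert_space)"
  by (metis cinner_scaleC_left scaleC_of_real complex_cnj_complex_of_real)

lemma cinner_diff_right:
  "cinner x (y - z) = cinner x y - cinner x (z :: 'a :: complex_hilbert_space)"
  using cinner_add_right[of x "y - z" z] by simp

lemma cinner_diff_left: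
  "cinner (x - y) z = cinner x z - cinner y (z :: 'a :: complex_hilbert_space)"
  using cinner_add_left[of "x - y" y z] by simp

lemma norm_add_sq:
  "(norm (x + y))\<^sup>2 = (norm x)\<^sup>2 + 2 * Re (cinner x y) + (norm (y :: 'a :: complex_hilbert_space))\<^sup>2"
proof -
  have "complex_of_real ((norm (x + y))\<^sup>2)
      = complex_of_real ((norm x)\<^sup>2) + (cinner x y + cnj (cinner x y)) + complex_of_real ((norm y)\<^sup>2)"
    by (simp only: flip: cinner_self cinner_commute[of y x])
      (simp add: cinner_add_left cinner_add_right)
  then have "complex_of_real ((norm (x + y))\<^sup>2)
      = complex_of_real ((norm x)\<^sup>2 + 2 * Re (cinner x y) + (norm y)\<^sup>2)"
    by (simp add: complex_add_cnj)
  then show ?thesis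
    by (simp only: of_real_eq_iff)
qed

text \<open>
  The triangle inequality is part of the assumptions on the norm, so the Cauchy-Schwarz inequality
  can be read off by squaring it.
\<close>

lemma Re_cinner_le: "Re (cinner x y) \<le> norm x * norm (y :: 'a :: complex_hilbert_space)"
proof -
  have "(norm (x + y))\<^sup>2 \<le> (norm x + norm y)\<^sup>2"
    by (simp add: norm_triangle_ineq)
  then show ?thesis
    by (simp add: norm_add_sq power2_sum)
qed

lemma cmod_cinner_le: "cmod (cinner x y) \<le> norm x * norm (y :: 'a :: complex_hilbert_space)"
proof (cases "cinner x y = 0")
  case False
  define u where "u = cnj (cinner x y) / cmod (cinner x y)"
  have "cmod u = 1"
    using False by (simp add: u_def norm_divide)
  have "cinner x (scaleC u y) = complex_of_real (cmod (cinner x y))"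
    using False complex_norm_square[of "cinner x y"]
    by (simp add: cinner_scaleC_right u_def field_simps power2_eq_square)
  then have "cmod (cinner x y) = Re (cinner x (scaleC u y))"
    by simp
  also have "\<dots> \<le> norm x * norm y"
    using Re_cinner_le[of x "scaleC u y"] \<open>cmod u = 1\<close> by (simp add: norm_scaleC)
  finally show ?thesis .
qed simp

lemma cinner_eqI:
  assumes "\<And>y. cinner x y = cinner x' (y :: 'a :: complex_hilbert_space)"
  shows "x = x'"
proof -
  have "cinner (x - x') (x - x') = 0"
    by (simp add: cinner_diff_left assms)
  then show ?thesis
    by (simp add: cinner_self)
qed

text \<open>
  Riesz representation. The representing vector minimises \<open>\<parallel>x\<parallel>\<^sup>2 - 2 \<phi>(x)\<close>: the parallelogram law
  makes every minimising sequence Cauchy, and the first variation at the minimum vanishes.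
\<close>

lemma real_riesz_representation:
  fixes \<phi> :: "'a :: complex_hilbert_space \<Rightarrow> real"
  assumes "bounded_linear \<phi>"
  shows "\<exists>x. \<forall>y. Re (cinner x y) = \<phi> y"
proof -
  interpret \<phi>: bounded_linear \<phi> by fact
  define J where "J x = (norm x)\<^sup>2 - 2 * \<phi> x" for x
  obtain K where K: "\<And>x. norm (\<phi> x) \<le> norm x * K"
    using \<phi>.bounded by blast
  have bdd: "- K\<^sup>2 \<le> J x" for x
  proof -
    have "0 \<le> (norm x - K)\<^sup>2"
      by simp
    then show ?thesis
      using K[of x] by (simp add: J_def power2_diff)
  qed
  define m where "m = (INF x. J x)"
  have bb: "bdd_below (range J)"
    using bdd by (auto intro!: bdd_belowI)
  have m_le: "m \<le> J x" for x
    unfolding m_def by (rule cINF_lower[OF bb]) simp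
  have parallelogram: "(norm (x - y))\<^sup>2 = 2 * (J x + J y - 2 * J ((1/2) *\<^sub>R (x + y)))" for x y
  proof -
    have "(norm (x - y))\<^sup>2 + (norm (x + y))\<^sup>2 = 2 * (norm x)\<^sup>2 + 2 * (norm y)\<^sup>2"
      using norm_add_sq[of x y] norm_add_sq[of x "- y"] cinner_scaleR_right[of x "-1" y]
      by simp
    moreover have "(norm ((1/2) *\<^sub>R (x + y)))\<^sup>2 = (norm (x + y))\<^sup>2 / 4"
      by (simp only: norm_scaleR power_mult_distrib) (simp add: power2_eq_square)
    moreover have "\<phi> ((1/2) *\<^sub>R (x + y)) = (\<phi> x + \<phi> y) / 2"
      by (simp only: \<phi>.scaleR \<phi>.add) simp
    ultimately show ?thesis
      by (simp only: J_def) (simp add: field_simps)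
  qed
  have "\<exists>x. J x < m + 1 / (real n + 1)" for n
  proof -
    have "(INF x. J x) < m + 1 / (real n + 1)"
      by (simp add: m_def[symmetric])
    then show ?thesis
      using cINF_less_iff[OF _ bb] by auto
  qed
  then obtain x where x: "\<And>n. J (x n) < m + 1 / (real n + 1)"
    by metis
  have close: "(norm (x i - x j))\<^sup>2 \<le> 4 * (1 / (real n + 1))" if "n \<le> i" "n \<le> j" for i j n
  proof -
    have "1 / (real i + 1) \<le> 1 / (real n + 1)" "1 / (real j + 1) \<le> 1 / (real n + 1)"
      using that by (auto intro!: divide_left_mono)
    then have "J (x i) < m + 1 / (real n + 1)" "J (x j) < m + 1 / (real n + 1)"
      using x[of i] x[of j] by linarith+
    moreover have "2 * (a + b - 2 * c) \<le> 4 * k" if "a < m + k" "b < m + k" "m \<le> c" for a b c k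
      using that by auto
    ultimately show ?thesis
      unfolding parallelogram[of "x i" "x j"] using m_le by blast
  qed
  have "Cauchy x"
  proof (rule metric_CauchyI)
    fix e :: real assume "0 < e"
    obtain n :: nat where n: "4 / e\<^sup>2 < real n"
      using reals_Archimedean2 by blast
    then have "4 < real n * e\<^sup>2"
      using \<open>0 < e\<close> by (simp add: pos_divide_less_eq)
    also have "\<dots> \<le> (real n + 1) * e\<^sup>2"
      by (intro mult_right_mono) auto
    finally have small: "4 * (1 / (real n + 1)) < e\<^sup>2"
      by (simp add: pos_divide_less_eq mult.commute add_pos_nonneg)
    have "norm (x i - x j) < e" if "n \<le> i" "n \<le> j" for i j
      by (rule power2_less_imp_less[OF order.strict_trans1[OF close[OF that] small]])
        (simp add: \<open>0 < e\<close> less_imp_le)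
    then show "\<exists>N. \<forall>i\<ge>N. \<forall>j\<ge>N. dist (x i) (x j) < e"
      by (auto simp: dist_norm)
  qed
  then obtain l where l: "x \<longlonglongrightarrow> l"
    by (auto simp: Cauchy_convergent_iff convergent_def)
  have "(\<lambda>n. J (x n)) \<longlonglongrightarrow> J l"
    unfolding J_def by (intro tendsto_intros l \<phi>.tendsto)
  moreover have "(\<lambda>n. m + 1 / (real n + 1)) \<longlonglongrightarrow> m + 0"
    by (intro tendsto_intros) real_asymp
  ultimately have "J l \<le> m"
    using LIMSEQ_le[of "\<lambda>n. J (x n)" "J l" "\<lambda>n. m + 1 / (real n + 1)" m] x
    by (auto intro: less_imp_le)
  \<comment> \<open>the value of \<open>J\<close> near its minimum point, along a real line\<close>
  have variation: "0 \<le> 2 * t * (Re (cinner l y) - \<phi> y) + t\<^sup>2 * (norm y)\<^sup>2" for t y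
  proof -
    have "J (l + t *\<^sub>R y) = J l + 2 * t * (Re (cinner l y) - \<phi> y) + t\<^sup>2 * (norm y)\<^sup>2"
      by (simp add: J_def norm_add_sq cinner_scaleR_right \<phi>.add \<phi>.scaleR power_mult_distrib
          algebra_simps)
    then show ?thesis
      using m_le[of "l + t *\<^sub>R y"] \<open>J l \<le> m\<close> by simp
  qed
  have "Re (cinner l y) = \<phi> y" for y
  proof -
    define d where "d = Re (cinner l y) - \<phi> y"
    define b where "b = (norm y)\<^sup>2 + 1"
    have "0 < b"
      by (simp add: b_def add_nonneg_pos)
    \<comment> \<open>A step of length \<open>- d / b\<close> would lower \<open>J\<close> if \<open>d\<close> were not zero.\<close>
    have "0 \<le> 2 * (- d / b) * d + (- d / b)\<^sup>2 * (b - 1)"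
      using variation[of "- d / b" y] by (simp add: d_def b_def)
    also have "\<dots> = - d\<^sup>2 * (b + 1) / b\<^sup>2"
      using \<open>0 < b\<close> by (simp add: field_simps power2_eq_square)
    finally have "d\<^sup>2 * (b + 1) \<le> 0"
      using \<open>0 < b\<close> by (simp add: field_simps)
    then have "d = 0"
      using \<open>0 < b\<close> by (smt (verit) zero_less_mult_iff zero_less_power2)
    then show ?thesis
      by (simp add: d_def)
  qed
  then show ?thesis
    by blast
qed

text \<open>
  The definition of \<open>adj\<close> is a definite description; Riesz representation of
  \<open>y \<mapsto> \<langle>x, A y\<rangle>\<close> provides its value at \<open>x\<close>.
\<close>

lemma ex_adjoint:
  fixes A :: "'a :: complex_hilbert_space op"
  assumes "clinear_op A"
  shows "\<exists>B :: 'a op. \<forall>x y. cinner (B x) y = cinner x (A y)"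
proof -
  have "\<exists>v. \<forall>y. cinner v y = cinner x (A y)" for x
  proof -
    have "bounded_linear (\<lambda>y. Re (cinner x (A y)))"
    proof (rule bounded_linear_intro[where K = "norm x * norm A"])
      fix y
      have "\<bar>Re (cinner x (A y))\<bar> \<le> norm x * norm (A y)"
        using abs_Re_le_cmod cmod_cinner_le order_trans by blast
      also have "\<dots> \<le> norm x * (norm A * norm y)"
        by (intro mult_left_mono norm_blinfun) simp
      finally show "norm (Re (cinner x (A y))) \<le> norm y * (norm x * norm A)"
        by (simp add: mult_ac)
    qed (simp_all add: blinfun.add_right blinfun.scaleR_right cinner_add_right cinner_scaleR_right)
    then obtain v where v: "\<And>y. Re (cinner v y) = Re (cinner x (A y))"
      using real_riesz_representation by blast
    \<comment> \<open>The real part of the functional determines it: the imaginary part at \<open>y\<close> is minus the real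
      part at \<open>\<i> y\<close>.\<close>
    have "cinner v y = cinner x (A y)" for y
      using v[of y] v[of "scaleC \<i> y"] assms
      by (simp add: complex_eq_iff clinear_op_def cinner_scaleC_right)
    then show ?thesis
      by blast
  qed
  then obtain B where B: "\<And>x y. cinner (B x) y = cinner x (A y)"
    by metis
  have "bounded_linear B"
  proof (rule bounded_linear_intro[where K = "norm A"])
    show "B (x + y) = B x + B y" for x y
      by (rule cinner_eqI) (simp add: B cinner_add_left)
    show "B (r *\<^sub>R x) = r *\<^sub>R B x" for r x
      by (rule cinner_eqI) (simp add: B cinner_scaleR_left)
    fix x
    have "complex_of_real ((norm (B x))\<^sup>2) = cinner x (A (B x))"
      by (simp only: B cinner_self[symmetric])
    then have "(norm (B x))\<^sup>2 = Re (cinner x (A (B x)))"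
      by (metis Re_complex_of_real)
    also have "\<dots> \<le> norm x * norm (A (B x))"
      by (rule Re_cinner_le)
    also have "\<dots> \<le> norm x * (norm A * norm (B x))"
      by (intro mult_left_mono norm_blinfun) simp
    finally have "norm (B x) * norm (B x) \<le> (norm x * norm A) * norm (B x)"
      by (simp add: power2_eq_square mult_ac)
    then show "norm (B x) \<le> norm x * norm A"
      by (cases "norm (B x) = 0") (auto simp: mult_le_cancel_right)
  qed
  then have "\<forall>x y. cinner (Blinfun B x) y = cinner x (A y)"
    by (simp add: bounded_linear_Blinfun_apply B)
  then show ?thesis
    by blast
qed

lemma cinner_adj_left:
  assumes "clinear_op A"
  shows "cinner (adj A x) y = cinner x (A y)"
proof -
  have "\<exists>!B. \<forall>x y. cinner (blinfun_apply B x) y = cinner x (A y)"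
  proof (rule ex_ex1I[OF ex_adjoint[OF assms]])
    fix B C
    assume "\<forall>x y. cinner (blinfun_apply B x) y = cinner x (A y)"
      and "\<forall>x y. cinner (blinfun_apply C x) y = cinner x (A y)"
    then show "B = C"
      by (intro blinfun_eqI cinner_eqI) simp
  qed
  from theI'[OF this] show ?thesis
    by (simp add: adj_def)
qed

lemma cinner_adj_right: "clinear_op A \<Longrightarrow> cinner x (adj A y) = cinner (A x) y"
  by (metis cinner_adj_left cinner_commute)

lemma adj_eqI:
  fixes A B :: "'a :: complex_hilbert_space op"
  assumes "clinear_op A" and "\<And>x y. cinner (B x) y = cinner x (A y)"
  shows "adj A = B"
  by (intro blinfun_eqI cinner_eqI) (simp add: assms cinner_adj_left)

lemma clinear_op_adj: "clinear_op A \<Longrightarrow> clinear_op (adj A)"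
  unfolding clinear_op_def[of "adj A"]
  by (intro allI cinner_eqI) (simp add: cinner_adj_left cinner_scaleC_left)

lemma adj_adj: "clinear_op A \<Longrightarrow> adj (adj A) = A"
  by (intro adj_eqI clinear_op_adj) (simp_all add: cinner_adj_right)

lemma norm_adj_le:
  assumes "clinear_op A"
  shows "norm (adj A) \<le> norm A"
proof (rule norm_blinfun_bound)
  fix x
  have "complex_of_real ((norm (adj A x))\<^sup>2) = cinner x (A (adj A x))"
    by (simp only: cinner_adj_left[OF assms] cinner_self[symmetric])
  then have "(norm (adj A x))\<^sup>2 = Re (cinner x (A (adj A x)))"
    by (metis Re_complex_of_real)
  also have "\<dots> \<le> norm x * norm (A (adj A x))"
    by (rule Re_cinner_le)
  also have "\<dots> \<le> norm x * (norm A * norm (adj A x))"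
    by (intro mult_left_mono norm_blinfun) simp
  finally have "norm (adj A x) * norm (adj A x) \<le> (norm A * norm x) * norm (adj A x)"
    by (simp add: power2_eq_square mult_ac)
  then show "norm (adj A x) \<le> norm A * norm x"
    by (cases "norm (adj A x) = 0") (auto simp: mult_le_cancel_right)
qed simp

section \<open>Operator algebra\<close>

lemmas compose_add_left = bounded_bilinear.add_left[OF bounded_bilinear_blinfun_compose]
lemmas compose_add_right = bounded_bilinear.add_right[OF bounded_bilinear_blinfun_compose]
lemmas compose_diff_left = bounded_bilinear.diff_left[OF bounded_bilinear_blinfun_compose]
lemmas compose_diff_right = bounded_bilinear.diff_right[OF bounded_bilinear_blinfun_compose]
lemmas compose_scaleR_left = bounded_bilinear.scaleR_left[OF bounded_bilinear_blinfun_compose]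
lemmas compose_scaleR_right = bounded_bilinear.scaleR_right[OF bounded_bilinear_blinfun_compose]
lemmas compose_sum_left = bounded_bilinear.sum_left[OF bounded_bilinear_blinfun_compose]

lemma compose_id_left [simp]: "id_blinfun o\<^sub>L A = A"
  by (rule blinfun_eqI) simp

lemma compose_id_right [simp]: "A o\<^sub>L id_blinfun = A"
  by (rule blinfun_eqI) simp

lemma compose_assoc: "(A o\<^sub>L B) o\<^sub>L C = A o\<^sub>L (B o\<^sub>L C)"
  by (rule blinfun_eqI) simp

lemma norm_id_blinfun_le: "norm (id_blinfun :: 'a :: complex_hilbert_space op) \<le> 1"
  by (rule norm_blinfun_bound) auto

lemma op_scale_apply [simp]: "op_scale c A x = scaleC c (A x)"
  by transfer simp

lemma op_scale_of_real: "op_scale (complex_of_real a) A = a *\<^sub>R A"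
  by (rule blinfun_eqI) (simp add: scaleC_of_real blinfun.scaleR_left)

lemma op_scale_op_scale: "op_scale c (op_scale d A) = op_scale (c * d) A"
  by (rule blinfun_eqI) (simp add: scaleC_scaleC)

lemma op_scale_add_left: "op_scale (c + d) A = op_scale c A + op_scale d A"
  by (rule blinfun_eqI) (simp add: scaleC_add_left blinfun.add_left)

lemma op_scale_diff_left: "op_scale (c - d) A = op_scale c A - op_scale d A"
  using op_scale_add_left[of "c - d" d A] by simp

lemma op_scale_sum_left: "op_scale (sum f I) A = (\<Sum>i\<in>I. op_scale (f i) A)"
proof -
  have "op_scale 0 A = 0"
    using op_scale_of_real[of 0 A] by simp
  then show ?thesis
    by (induction I rule: infinite_finite_induct) (simp_all add: op_scale_add_left)
qed

lemma op_scale_diff_right: "op_scale c (A - B) = op_scale c A - op_scale c B"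
proof -
  have "op_scale c (A - B) + op_scale c B = op_scale c A"
    by (rule blinfun_eqI) (simp add: blinfun.add_left blinfun.diff_left flip: scaleC_add_right)
  then show ?thesis
    by (simp add: algebra_simps)
qed

lemma compose_op_scale_left: "op_scale c A o\<^sub>L B = op_scale c (A o\<^sub>L B)"
  by (rule blinfun_eqI) simp

lemma compose_op_scale_right: "clinear_op A \<Longrightarrow> A o\<^sub>L op_scale c B = op_scale c (A o\<^sub>L B)"
  by (rule blinfun_eqI) (simp add: clinear_op_def)

lemma norm_op_scale: "norm (op_scale c A) = cmod c * norm A"
proof (rule antisym)
  have le: "norm (op_scale c A) \<le> cmod c * norm A" for c and A :: "'a op"
  proof (rule norm_blinfun_bound)
    show "norm (op_scale c A x) \<le> cmod c * norm A * norm x" for x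
      by (simp add: norm_scaleC mult.assoc mult_left_mono norm_blinfun)
  qed simp
  show "norm (op_scale c A) \<le> cmod c * norm A"
    by (rule le)
  show "cmod c * norm A \<le> norm (op_scale c A)"
  proof (cases "c = 0")
    case False
    have "A = op_scale (inverse c) (op_scale c A)"
      using False op_scale_of_real[of 1 A] by (simp add: op_scale_op_scale)
    then have "norm A \<le> cmod (inverse c) * norm (op_scale c A)"
      using le by metis
    then show ?thesis
      using False by (simp add: norm_inverse norm_divide field_simps)
  qed simp
qed

lemma adj_id: "adj id_blinfun = id_blinfun"
  by (rule adj_eqI) (simp_all add: clinear_op_def)

lemma clinear_op_compose: "clinear_op A \<Longrightarrow> clinear_op B \<Longrightarrow> clinear_op (A o\<^sub>L B)"
  by (simp add: clinear_op_def)

lemma clinear_op_add: "clinear_op A \<Longrightarrow> clinear_op B \<Longrightarrow> clinear_op (A + B)"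
  by (simp add: clinear_op_def blinfun.add_left scaleC_add_right)

lemma clinear_op_op_scale: "clinear_op A \<Longrightarrow> clinear_op (op_scale c A)"
  by (simp add: clinear_op_def scaleC_scaleC mult.commute)

lemma adj_compose:
  "clinear_op A \<Longrightarrow> clinear_op B \<Longrightarrow> adj (A o\<^sub>L B) = adj B o\<^sub>L adj A"
  by (rule adj_eqI) (simp_all add: clinear_op_compose cinner_adj_left)

lemma adj_add: "clinear_op A \<Longrightarrow> clinear_op B \<Longrightarrow> adj (A + B) = adj A + adj B"
  by (rule adj_eqI)
    (simp_all add: clinear_op_add cinner_adj_left blinfun.add_left cinner_add_left cinner_add_right)

lemma adj_op_scale: "clinear_op A \<Longrightarrow> adj (op_scale c A) = op_scale (cnj c) (adj A)"
  by (rule adj_eqI)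
    (simp_all add: clinear_op_op_scale cinner_adj_left cinner_scaleC_left cinner_scaleC_right)

lemma op_pow_0 [simp]: "op_pow A 0 = id_blinfun"
  by (simp add: op_pow_def)

lemma op_pow_Suc [simp]: "op_pow A (Suc n) = A o\<^sub>L op_pow A n"
  by (simp add: op_pow_def)

lemma op_pow_add: "op_pow A (m + n) = op_pow A m o\<^sub>L op_pow A n"
  by (induction m) (simp_all add: compose_assoc)

lemma op_pow_Suc_right: "op_pow A (Suc n) = op_pow A n o\<^sub>L A"
  using op_pow_add[of A n 1] by simp

lemma op_pow_mult: "op_pow A (m * n) = op_pow (op_pow A m) n"
  by (induction n) (simp_all add: op_pow_add)

lemma norm_op_pow_le: "norm (op_pow A n) \<le> norm A ^ n"
proof (induction n)
  case 0
  then show ?case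
    by (simp add: norm_id_blinfun_le)
next
  case (Suc n)
  have "norm (A o\<^sub>L op_pow A n) \<le> norm A * norm (op_pow A n)"
    by (rule norm_blinfun_compose)
  also have "\<dots> \<le> norm A * norm A ^ n"
    using Suc by (rule mult_left_mono) simp
  finally show ?case
    by simp
qed

lemma op_pow_scaleR: "op_pow (a *\<^sub>R A) n = a ^ n *\<^sub>R op_pow A n"
  by (induction n) (simp_all add: compose_scaleR_left compose_scaleR_right)

lemma op_pow_inverse:
  assumes "A o\<^sub>L B = id_blinfun"
  shows "op_pow A n o\<^sub>L op_pow B n = id_blinfun"
proof (induction n)
  case (Suc n)
  have "op_pow A (Suc n) o\<^sub>L op_pow B (Suc n) = op_pow A n o\<^sub>L (A o\<^sub>L B) o\<^sub>L op_pow B n"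
    by (simp only: op_pow_Suc_right[of A] op_pow_Suc[of B] compose_assoc)
  then show ?case
    using Suc assms by simp
qed simp

lemma clinear_op_id: "clinear_op id_blinfun"
  by (simp add: clinear_op_def)

lemma op_geometric_sum:
  "(\<Sum>m<n. op_pow A m) o\<^sub>L (id_blinfun - A) = id_blinfun - op_pow A n"
  "(id_blinfun - A) o\<^sub>L (\<Sum>m<n. op_pow A m) = id_blinfun - op_pow A n"
proof -
  show "(\<Sum>m<n. op_pow A m) o\<^sub>L (id_blinfun - A) = id_blinfun - op_pow A n"
  proof (induction n)
    case (Suc n)
    then show ?case
      by (simp add: compose_add_left compose_diff_right[of "op_pow A n"] op_pow_Suc_right
          del: op_pow_Suc)
  qed simp
  show "(id_blinfun - A) o\<^sub>L (\<Sum>m<n. op_pow A m) = id_blinfun - op_pow A n"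
    by (induction n) (simp_all add: compose_add_right compose_diff_left)
qed

section \<open>Resolvents and growth of powers\<close>

lemma op_pow_op_scale:
  fixes B :: "'a :: complex_hilbert_space op"
  shows "clinear_op B \<Longrightarrow> op_pow (op_scale c B) n = op_scale (c ^ n) (op_pow B n)"
proof (induction n)
  case 0
  then show ?case
    using op_scale_of_real[of 1 "id_blinfun :: 'a op"] by simp
next
  case (Suc n)
  then show ?case
    by (simp add: compose_op_scale_left compose_op_scale_right op_scale_op_scale)
qed

text \<open>
  \<open>F z\<close> is the resolvent \<open>1 / (1 - z B)\<close>, which exists on the disc of radius \<open>R\<close> when the spectrum
  of \<open>B\<close> lies strictly inside the circle of radius \<open>1 / R\<close>. The aim is the upper half of the spectral radius
  formula, \<open>t\<^sup>n \<parallel>B\<^sup>n\<parallel> \<rightarrow> 0\<close> for \<open>t < R\<close>. Instead of a Laurent expansion of operator-valued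
  holomorphic functions it uses averages of the resolvent over roots of unity, following Rickart.
\<close>

locale resolvent_on_disc =
  fixes B :: "'a :: complex_hilbert_space op" and R :: real and F :: "complex \<Rightarrow> 'a op"
  assumes clinear: "clinear_op B"
    and R_nonneg: "0 \<le> R"
    and left_inverse: "cmod z \<le> R \<Longrightarrow> F z o\<^sub>L (id_blinfun - op_scale z B) = id_blinfun"
    and right_inverse: "cmod z \<le> R \<Longrightarrow> (id_blinfun - op_scale z B) o\<^sub>L F z = id_blinfun"
begin

lemma resolvent_identity:
  assumes "cmod z \<le> R" "cmod w \<le> R"
  shows "F z - F w = F z o\<^sub>L (op_scale (z - w) B o\<^sub>L F w)"
proof -
  have "F z o\<^sub>L (op_scale (z - w) B o\<^sub>L F w)
      = (F z o\<^sub>L ((id_blinfun - op_scale w B) o\<^sub>L F w))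
        - ((F z o\<^sub>L (id_blinfun - op_scale z B)) o\<^sub>L F w)"
    by (simp add: op_scale_diff_left compose_diff_left compose_diff_right compose_assoc)
  then show ?thesis
    using assms by (simp add: left_inverse right_inverse)
qed

lemma norm_resolvent_diff:
  assumes "cmod z \<le> R" "cmod w \<le> R"
  shows "norm (F z - F w) \<le> norm (F z) * (cmod (z - w) * norm B * norm (F w))"
proof -
  have "norm (F z - F w) \<le> norm (F z) * norm (op_scale (z - w) B o\<^sub>L F w)"
    using assms by (simp add: resolvent_identity norm_blinfun_compose)
  also have "\<dots> \<le> norm (F z) * (norm (op_scale (z - w) B) * norm (F w))"
    by (intro mult_left_mono norm_blinfun_compose) simp
  finally show ?thesis
    by (simp add: norm_op_scale)
qed

lemma resolvent_locally_bounded: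
  assumes "cmod z \<le> R" "cmod w \<le> R" "cmod (w - z) * (norm B * norm (F z)) \<le> 1/2"
  shows "norm (F w) \<le> 2 * norm (F z)"
proof -
  have "norm (F w) \<le> norm (F z) + norm (F w - F z)"
    by (rule norm_triangle_sub)
  also have "norm (F w - F z) \<le> norm (F w) * (cmod (w - z) * norm B * norm (F z))"
    using assms by (intro norm_resolvent_diff)
  also have "\<dots> \<le> norm (F w) * (1/2)"
    using assms(3) by (intro mult_left_mono) (simp_all add: mult.assoc)
  finally show ?thesis
    by simp
qed

text \<open>
  The resolvent identity bounds \<open>F\<close> near each point by twice its norm there; compactness of the disc
  turns this into a global bound.
\<close>

lemma resolvent_bounded: "\<exists>M\<ge>0. \<forall>z. cmod z \<le> R \<longrightarrow> norm (F z) \<le> M"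
proof -
  define \<delta> where "\<delta> z = 1 / (2 * (norm B * norm (F z) + 1))" for z
  have pos: "0 < norm B * norm (F z) + 1" for z
    by (simp add: add_nonneg_pos)
  have \<delta>_pos: "0 < \<delta> z" for z
    unfolding \<delta>_def using pos[of z] by (intro divide_pos_pos mult_pos_pos) simp_all
  have cover: "cball 0 R \<subseteq> (\<Union>z\<in>cball 0 R. ball z (\<delta> z))"
    using \<delta>_pos by force
  obtain C where C: "C \<subseteq> cball 0 R" "finite C" "cball 0 R \<subseteq> (\<Union>z\<in>C. ball z (\<delta> z))"
    by (rule compactE_image[OF compact_cball _ cover]) auto
  have "norm (F w) \<le> (\<Sum>z\<in>C. 2 * norm (F z))" if w: "cmod w \<le> R" for w
  proof -
    have "w \<in> cball 0 R"
      using w by simp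
    with C(3) obtain z where z: "z \<in> C" "w \<in> ball z (\<delta> z)"
      by blast
    have "cmod (w - z) * (norm B * norm (F z) + 1) \<le> \<delta> z * (norm B * norm (F z) + 1)"
      using z(2) pos[of z]
      by (intro mult_right_mono) (auto simp: dist_norm norm_minus_commute)
    also have "\<dots> = 1/2"
      using pos[of z] by (simp add: \<delta>_def)
    finally have "cmod (w - z) * (norm B * norm (F z)) \<le> 1/2"
      by (simp add: distrib_left) (smt (verit) norm_ge_zero)
    then have "norm (F w) \<le> 2 * norm (F z)"
      using z(1) C(1) w by (intro resolvent_locally_bounded) auto
    also have "\<dots> \<le> (\<Sum>z\<in>C. 2 * norm (F z))"
      using z(1) C(2) by (intro member_le_sum) auto
    finally show ?thesis .
  qed
  then show ?thesis
    by (intro exI[of _ "\<Sum>z\<in>C. 2 * norm (F z)"]) (auto intro: sum_nonneg)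
qed

text \<open>
  The average of the resolvent over the \<open>n\<close>-th roots of unity times \<open>t\<close>; it is the resolvent
  \<open>1 / (1 - t\<^sup>n B\<^sup>n)\<close> of the power \<open>B\<^sup>n\<close>.
\<close>

definition root_average :: "nat \<Rightarrow> real \<Rightarrow> 'a op" where
  "root_average n t = (1 / real n) *\<^sub>R (\<Sum>j<n. F (cis (2 * pi * real j / real n) * of_real t))"

lemma cmod_root_mult: "0 \<le> t \<Longrightarrow> cmod (cis a * of_real t) = t"
  by (simp add: norm_mult)

lemma sum_roots_power:
  assumes "m < n"
  shows "(\<Sum>j<n. (cis (2 * pi * real j / real n)) ^ m) = (if m = 0 then of_nat n else 0)"
proof (cases "m = 0")
  case False
  define w where "w = cis (2 * pi * real m / real n)"
  have "inj_on (\<lambda>k. cis (2 * pi * real k / real n)) {..<n}"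
    using assms by (intro bij_betw_imp_inj_on[OF Complex.bij_betw_roots_unity]) auto
  then have "w \<noteq> cis (2 * pi * real 0 / real n)"
    using assms False inj_onD[of "\<lambda>k. cis (2 * pi * real k / real n)" "{..<n}" m 0]
    unfolding w_def by auto
  then have "w \<noteq> 1"
    by simp
  have "w ^ n = cis (2 * pi * real m)"
    using assms by (simp add: w_def Complex.DeMoivre)
  also have "\<dots> = 1"
    by (simp add: cis_multiple_2pi)
  finally have "w ^ n = 1" .
  have "(\<Sum>j<n. (cis (2 * pi * real j / real n)) ^ m) = (\<Sum>j<n. w ^ j)"
    by (simp add: w_def Complex.DeMoivre mult_ac)
  also have "\<dots> = 0"
    using \<open>w \<noteq> 1\<close> \<open>w ^ n = 1\<close> by (simp add: sum_gp_strict)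
  finally show ?thesis
    using False by simp
qed simp

text \<open>
  With \<open>w\<^sup>n = t\<^sup>n\<close>, the geometric sum turns \<open>F w\<close> times \<open>1 - t\<^sup>n B\<^sup>n\<close> into \<open>\<Sum>m<n. w\<^sup>m B\<^sup>m\<close>;
  averaging over all such \<open>w\<close> leaves the term \<open>m = 0\<close>.
\<close>

lemma root_average_left_inverse:
  assumes "0 < n" "0 \<le> t" "t \<le> R"
  shows "root_average n t o\<^sub>L (id_blinfun - t ^ n *\<^sub>R op_pow B n) = id_blinfun"
proof -
  define w where "w j = cis (2 * pi * real j / real n) * complex_of_real t" for j
  have summand: "F (w j) o\<^sub>L (id_blinfun - t ^ n *\<^sub>R op_pow B n)
      = (\<Sum>m<n. op_scale (w j ^ m) (op_pow B m))" for j
  proof -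
    have "real n * (2 * pi * real j / real n) = 2 * pi * real j"
      using assms by simp
    then have "cis (2 * pi * real j / real n) ^ n = cis (2 * pi * real j)"
      by (simp only: Complex.DeMoivre)
    then have wn: "w j ^ n = complex_of_real (t ^ n)"
      by (simp add: w_def power_mult_distrib cis_multiple_2pi)
    have "id_blinfun - t ^ n *\<^sub>R op_pow B n
        = (id_blinfun - op_scale (w j) B) o\<^sub>L (\<Sum>m<n. op_scale (w j ^ m) (op_pow B m))"
      using op_geometric_sum(2)[of "op_scale (w j) B" n]
      by (simp only: op_pow_op_scale[OF clinear] wn op_scale_of_real)
    then have "F (w j) o\<^sub>L (id_blinfun - t ^ n *\<^sub>R op_pow B n)
        = (F (w j) o\<^sub>L (id_blinfun - op_scale (w j) B)) o\<^sub>L (\<Sum>m<n. op_scale (w j ^ m) (op_pow B m))"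
      by (simp only: compose_assoc)
    then show ?thesis
      using assms by (simp add: left_inverse w_def norm_mult)
  qed
  have "(\<Sum>j<n. F (w j)) o\<^sub>L (id_blinfun - t ^ n *\<^sub>R op_pow B n)
      = (\<Sum>j<n. \<Sum>m<n. op_scale (w j ^ m) (op_pow B m))"
    by (simp add: compose_sum_left summand)
  also have "\<dots> = (\<Sum>m<n. op_scale (\<Sum>j<n. w j ^ m) (op_pow B m))"
    by (subst sum.swap) (simp add: op_scale_sum_left)
  also have "\<dots> = (\<Sum>m<n. if m = 0 then op_scale (of_nat n) (op_pow B 0) else 0)"
  proof (intro sum.cong refl)
    fix m assume "m \<in> {..<n}"
    then have "(\<Sum>j<n. w j ^ m) = (if m = 0 then of_nat n else 0)"
      by (simp add: w_def power_mult_distrib sum_roots_power flip: sum_distrib_right)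
    then show "op_scale (\<Sum>j<n. w j ^ m) (op_pow B m)
        = (if m = 0 then op_scale (of_nat n) (op_pow B 0) else 0)"
      using op_scale_of_real[of 0 "op_pow B m"] by simp
  qed
  also have "\<dots> = real n *\<^sub>R id_blinfun"
    using assms op_scale_of_real[of "real n" "id_blinfun :: 'a op"] by simp
  finally show ?thesis
    using assms by (simp add: root_average_def compose_scaleR_left flip: w_def)
qed

lemma norm_root_average_le:
  assumes "0 < n" "0 \<le> t" "t \<le> R" and "\<And>z. cmod z \<le> R \<Longrightarrow> norm (F z) \<le> M"
  shows "norm (root_average n t) \<le> M"
proof -
  have "norm (\<Sum>j<n. F (cis (2 * pi * real j / real n) * of_real t)) \<le> (\<Sum>j<n. M)"
    using assms by (intro sum_norm_le) (simp add: cmod_root_mult)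
  then show ?thesis
    using assms(1) by (simp add: root_average_def field_simps)
qed

text \<open>
  The gain over a direct estimate of \<open>1 / (1 - t\<^sup>n B\<^sup>n)\<close> is that the Lipschitz constant in \<open>t\<close> does
  not depend on \<open>n\<close>.
\<close>

lemma norm_root_average_diff_le:
  assumes "0 < n" "0 \<le> t" "t \<le> R" "0 \<le> t'" "t' \<le> R" and M: "\<And>z. cmod z \<le> R \<Longrightarrow> norm (F z) \<le> M"
  shows "norm (root_average n t - root_average n t') \<le> M * M * norm B * \<bar>t - t'\<bar>"
proof -
  define w where "w j = cis (2 * pi * real j / real n)" for j
  have "0 \<le> M"
    using order_trans[OF norm_ge_zero M[of 0]] R_nonneg by simp
  have "norm (F (w j * of_real t) - F (w j * of_real t')) \<le> M * M * norm B * \<bar>t - t'\<bar>" for j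
  proof -
    have le: "cmod (w j * of_real t) \<le> R" "cmod (w j * of_real t') \<le> R"
      using assms by (simp_all add: w_def norm_mult)
    have "cmod (w j * of_real t - w j * of_real t') = \<bar>t - t'\<bar>"
      by (simp add: w_def norm_mult flip: right_diff_distrib of_real_diff)
    then have "norm (F (w j * of_real t) - F (w j * of_real t'))
        \<le> norm (F (w j * of_real t)) * (\<bar>t - t'\<bar> * norm B * norm (F (w j * of_real t')))"
      using norm_resolvent_diff[OF le] by simp
    also have "\<dots> \<le> M * (\<bar>t - t'\<bar> * norm B * M)"
      using M[OF le(1)] M[OF le(2)] \<open>0 \<le> M\<close> by (intro mult_mono) auto
    finally show ?thesis
      by (simp add: mult_ac)
  qed
  then have "norm (\<Sum>j<n. F (w j * of_real t) - F (w j * of_real t'))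
      \<le> (\<Sum>j<n. M * M * norm B * \<bar>t - t'\<bar>)"
    by (intro sum_norm_le) simp
  moreover have "root_average n t - root_average n t'
      = (1 / real n) *\<^sub>R (\<Sum>j<n. F (w j * of_real t) - F (w j * of_real t'))"
    by (simp add: root_average_def w_def sum_subtractf scaleR_diff_right)
  ultimately show ?thesis
    using assms(1) by (simp add: field_simps)
qed

text \<open>
  If \<open>t\<^sup>n B\<^sup>n\<close> tends to \<open>0\<close>, the average at \<open>t\<close> tends to \<open>1\<close>. By the uniform Lipschitz bound the
  average at a nearby \<open>t'\<close> is then within \<open>1/2\<close> of \<open>1\<close> for all large \<open>n\<close>, and so its inverse
  \<open>1 - t'\<^sup>n B\<^sup>n\<close> is within \<open>1\<close> of \<open>1\<close>.
\<close>

lemma norm_power_le_1_near_decay: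
  assumes decay: "(\<lambda>n. t ^ n * norm (op_pow B n)) \<longlonglongrightarrow> 0"
    and M: "\<And>z. cmod z \<le> R \<Longrightarrow> norm (F z) \<le> M"
    and "0 \<le> t" "t \<le> R" "0 \<le> t'" "t' \<le> R" "M * M * norm B * \<bar>t' - t\<bar> \<le> 1/4"
  shows "\<forall>\<^sub>F n in sequentially. t' ^ n * norm (op_pow B n) \<le> 1"
proof -
  have "(\<lambda>n. M * (t ^ n * norm (op_pow B n))) \<longlonglongrightarrow> M * 0"
    by (intro tendsto_intros decay)
  then have "\<forall>\<^sub>F n in sequentially. M * (t ^ n * norm (op_pow B n)) < 1/4"
    by (rule order_tendstoD) simp
  then show ?thesis
    using eventually_gt_at_top[of 0]
  proof eventually_elim
    case (elim n)
    define V where "V s = id_blinfun - s ^ n *\<^sub>R op_pow B n" for s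
    have inv: "root_average n s o\<^sub>L V s = id_blinfun" if "0 \<le> s" "s \<le> R" for s
      using root_average_left_inverse[OF elim(2) that] by (simp add: V_def)
    have "root_average n t - id_blinfun = root_average n t o\<^sub>L (t ^ n *\<^sub>R op_pow B n)"
      using inv[of t] assms by (simp add: V_def compose_diff_right algebra_simps)
    then have "norm (root_average n t - id_blinfun)
        \<le> norm (root_average n t) * (t ^ n * norm (op_pow B n))"
      using norm_blinfun_compose[of "root_average n t" "t ^ n *\<^sub>R op_pow B n"] assms by simp
    also have "\<dots> \<le> M * (t ^ n * norm (op_pow B n))"
      using assms elim by (intro mult_right_mono norm_root_average_le) auto
    also have "\<dots> \<le> 1/4"
      using elim by simp
    finally have "norm (root_average n t - id_blinfun) \<le> 1/4" .
    moreover have "norm (root_average n t' - root_average n t) \<le> M * M * norm B * \<bar>t' - t\<bar>"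
      using assms elim(2) by (intro norm_root_average_diff_le) auto
    ultimately have half: "norm (root_average n t' - id_blinfun) \<le> 1/2"
      using norm_triangle_ineq[of "root_average n t' - root_average n t" "root_average n t - id_blinfun"]
        assms(7) by simp
    have VI: "V t' = id_blinfun - ((root_average n t' - id_blinfun) o\<^sub>L V t')"
      using inv[of t'] assms by (simp add: compose_diff_left)
    have small: "norm ((root_average n t' - id_blinfun) o\<^sub>L V t') \<le> 1/2 * norm (V t')"
      using half mult_right_mono[OF half, of "norm (V t')"]
      by (meson norm_blinfun_compose norm_ge_zero order_trans)
    have "norm (V t') \<le> 1 + 1/2 * norm (V t')"
      using VI small norm_id_blinfun_le
        norm_triangle_ineq4[of id_blinfun "(root_average n t' - id_blinfun) o\<^sub>L V t'"]
      by (smt (verit))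
    moreover have "t' ^ n *\<^sub>R op_pow B n = (root_average n t' - id_blinfun) o\<^sub>L V t'"
      using VI by (simp add: V_def algebra_simps)
    then have "t' ^ n * norm (op_pow B n) = norm ((root_average n t' - id_blinfun) o\<^sub>L V t')"
      using assms by (metis norm_scaleR abs_of_nonneg zero_le_power)
    ultimately show ?case
      using small by linarith
  qed
qed

text \<open>
  The distance by which decay propagates is the same everywhere in the disc, so finitely many steps
  lead from \<open>0\<close> to any \<open>t < R\<close>.
\<close>

lemma power_decay:
  assumes "0 \<le> t" "t < R"
  shows "(\<lambda>n. t ^ n * norm (op_pow B n)) \<longlonglongrightarrow> 0"
proof -
  obtain M where "0 \<le> M" and M: "\<And>z. cmod z \<le> R \<Longrightarrow> norm (F z) \<le> M"
    using resolvent_bounded by blast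
  define L where "L = M * M * norm B"
  define \<eta> where "\<eta> = 1 / (4 * (L + 1))"
  have "0 \<le> L"
    using \<open>0 \<le> M\<close> by (simp add: L_def)
  then have \<eta>: "0 < \<eta>" "L * \<eta> \<le> 1/4"
    by (simp_all add: \<eta>_def field_simps)
  have "(\<lambda>n. t ^ n * norm (op_pow B n)) \<longlonglongrightarrow> 0" if "0 \<le> t" "t < R" "t \<le> real N * (\<eta> / 2)" for N t
    using that
  proof (induction N arbitrary: t)
    case 0
    then have "\<forall>\<^sub>F n in sequentially. t ^ n * norm (op_pow B n) = 0"
      by (intro eventually_mono[OF eventually_gt_at_top[of "0 :: nat"]]) auto
    then show ?case
      by (rule tendsto_eventually)
  next
    case (Suc N)
    \<comment> \<open>Decay at \<open>t\<^sub>0\<close> gives boundedness at \<open>t' > t\<close>, hence geometric decay at \<open>t\<close>.\<close>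
    define t\<^sub>0 where "t\<^sub>0 = max 0 (t - \<eta> / 2)"
    define t' where "t' = min R (t + \<eta> / 2)"
    have t: "0 \<le> t\<^sub>0" "t\<^sub>0 \<le> t" "t < t'" "t' \<le> R" "t' - t\<^sub>0 \<le> \<eta>"
      using Suc.prems \<eta> by (auto simp: t\<^sub>0_def t'_def)
    have "t - \<eta> / 2 \<le> real N * (\<eta> / 2)"
      using Suc.prems by (simp add: field_simps)
    moreover have "0 \<le> real N * (\<eta> / 2)"
      using \<eta> by simp
    ultimately have "t\<^sub>0 \<le> real N * (\<eta> / 2)"
      unfolding t\<^sub>0_def by (rule max.boundedI[rotated])
    then have decay: "(\<lambda>n. t\<^sub>0 ^ n * norm (op_pow B n)) \<longlonglongrightarrow> 0"
      using t Suc.prems by (intro Suc.IH) auto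
    have "L * \<bar>t' - t\<^sub>0\<bar> \<le> L * \<eta>"
      using t \<open>0 \<le> L\<close> by (intro mult_left_mono) auto
    then have "M * M * norm B * \<bar>t' - t\<^sub>0\<bar> \<le> 1/4"
      using \<eta> by (simp add: L_def)
    then have "\<forall>\<^sub>F n in sequentially. t' ^ n * norm (op_pow B n) \<le> 1"
      using t Suc.prems by (intro norm_power_le_1_near_decay[OF decay M]) auto
    then have "\<forall>\<^sub>F n in sequentially. norm (t ^ n * norm (op_pow B n)) \<le> (t / t') ^ n"
    proof eventually_elim
      case (elim n)
      have "t ^ n * norm (op_pow B n) = (t / t') ^ n * (t' ^ n * norm (op_pow B n))"
        using t Suc.prems by (simp add: power_divide)
      also have "\<dots> \<le> (t / t') ^ n * 1"
        using elim t Suc.prems by (intro mult_left_mono) auto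
      finally show ?case
        using Suc.prems by simp
    qed
    moreover have "(\<lambda>n. (t / t') ^ n) \<longlonglongrightarrow> 0"
      using t Suc.prems by (intro LIMSEQ_power_zero) (simp add: field_simps)
    ultimately show ?case
      by (rule Lim_null_comparison)
  qed
  moreover obtain N :: nat where "t / (\<eta> / 2) \<le> real N"
    using real_arch_simple by blast
  ultimately show ?thesis
    using assms \<eta> by (simp add: field_simps)
qed

end

section \<open>Traces on von Neumann algebras\<close>

text \<open>
  Complex linearity is itself a commutation relation, so that commutants are intersections of
  centralisers.
\<close>

lemma op_scale_id_commute_iff:
  "clinear_op A \<longleftrightarrow> (\<forall>c. A o\<^sub>L op_scale c id_blinfun = op_scale c id_blinfun o\<^sub>L A)"
proof
  assume "clinear_op A"
  then show "\<forall>c. A o\<^sub>L op_scale c id_blinfun = op_scale c id_blinfun o\<^sub>L A"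
    by (simp add: compose_op_scale_left compose_op_scale_right)
next
  assume commute: "\<forall>c. A o\<^sub>L op_scale c id_blinfun = op_scale c id_blinfun o\<^sub>L A"
  have "A (scaleC c x) = scaleC c (A x)" for c x
    using arg_cong[OF commute[rule_format, of c], of "\<lambda>B. blinfun_apply B x"] by simp
  then show "clinear_op A"
    by (simp add: clinear_op_def)
qed

lemma closed_commutant: "closed (commutant S)"
proof -
  have "closed {A :: 'a op. A o\<^sub>L B = B o\<^sub>L A}" for B
    by (intro closed_Collect_eq continuous_intros bounded_bilinear.continuous_on[OF bounded_bilinear_blinfun_compose])
  then have "closed ((\<Inter>c. {A :: 'a op. A o\<^sub>L op_scale c id_blinfun = op_scale c id_blinfun o\<^sub>L A})
      \<inter> (\<Inter>B\<in>S. {A. A o\<^sub>L B = B o\<^sub>L A}))"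
    by (intro closed_Int closed_INT ballI)
  moreover have "commutant S = (\<Inter>c. {A. A o\<^sub>L op_scale c id_blinfun = op_scale c id_blinfun o\<^sub>L A})
      \<inter> (\<Inter>B\<in>S. {A. A o\<^sub>L B = B o\<^sub>L A})"
    by (auto simp: commutant_def op_scale_id_commute_iff)
  ultimately show ?thesis
    by metis
qed

lemma commutant_id: "id_blinfun \<in> commutant S"
  by (simp add: commutant_def clinear_op_id)

lemma commutant_add: "A \<in> commutant S \<Longrightarrow> B \<in> commutant S \<Longrightarrow> A + B \<in> commutant S"
  by (simp add: commutant_def clinear_op_add compose_add_left compose_add_right)

lemma commutant_compose: "A \<in> commutant S \<Longrightarrow> B \<in> commutant S \<Longrightarrow> A o\<^sub>L B \<in> commutant S"
  by (simp add: commutant_def clinear_op_compose) (metis compose_assoc)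

lemma commutant_op_scale:
  "(\<And>B. B \<in> S \<Longrightarrow> clinear_op B) \<Longrightarrow> A \<in> commutant S \<Longrightarrow> op_scale c A \<in> commutant S"
  by (simp add: commutant_def clinear_op_op_scale compose_op_scale_left compose_op_scale_right)

lemma convex_seq_above_tangent:
  fixes c :: "nat \<Rightarrow> real"
  assumes convex: "\<And>i. i + 2 \<le> n \<Longrightarrow> 0 \<le> c (i + 2) - 2 * c (i + 1) + c i"
    and "i \<le> n"
  shows "c 0 + real i * (c 1 - c 0) \<le> c i"
proof -
  have slope: "c 1 - c 0 \<le> c (i + 1) - c i" if "i < n" for i
    using that
  proof (induction i)
    case (Suc i)
    then show ?case
      using convex[of i] by simp
  qed simp
  show ?thesis
    using \<open>i \<le> n\<close>
  proof (induction i)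
    case (Suc i)
    then show ?case
      using slope[of i] by (simp add: algebra_simps)
  qed simp
qed

text \<open>
  The norm of the positive operator \<open>1 - \<epsilon> P\<^sup>* P\<close> is estimated through its square root:
  \<open>\<parallel>u x\<parallel>\<^sup>2 = \<parallel>x\<parallel>\<^sup>2 - \<epsilon> \<parallel>P x\<parallel>\<^sup>2\<close>.
\<close>

lemma norm_square_le:
  assumes u: "clinear_op u" "adj u = u" and P: "clinear_op P"
    and eq: "u o\<^sub>L u = id_blinfun - \<epsilon> *\<^sub>R (adj P o\<^sub>L P)"
    and "0 \<le> \<epsilon>" "\<epsilon> \<le> 1" "0 \<le> a" "a \<le> 1" and below: "\<And>x. a * norm x ^ 2 \<le> norm (P x) ^ 2"
  shows "norm (u o\<^sub>L u) \<le> 1 - \<epsilon> * a"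
proof -
  have le1: "\<epsilon> * a \<le> 1"
    using assms by (simp add: mult_le_one)
  have "norm u \<le> sqrt (1 - \<epsilon> * a)"
  proof (rule norm_blinfun_bound)
    fix x
    have "complex_of_real ((norm (u x))\<^sup>2) = cinner x ((u o\<^sub>L u) x)"
      using cinner_adj_left[OF u(1), of x "u x"] u(2) by (simp only: cinner_self[symmetric]) simp
    also have "\<dots> = cinner x x - complex_of_real \<epsilon> * cinner (P x) (P x)"
      by (simp add: eq blinfun.diff_left blinfun.scaleR_left cinner_diff_right cinner_scaleR_right
          cinner_adj_right[OF clinear_op_adj[OF P], symmetric] cinner_adj_left[OF P]
          cinner_adj_right[OF P])
    finally have "complex_of_real ((norm (u x))\<^sup>2) = complex_of_real ((norm x)\<^sup>2 - \<epsilon> * (norm (P x))\<^sup>2)"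
      by (simp add: cinner_self)
    then have "(norm (u x))\<^sup>2 = (norm x)\<^sup>2 - \<epsilon> * (norm (P x))\<^sup>2"
      by (simp only: of_real_eq_iff)
    also have "\<dots> \<le> (norm x)\<^sup>2 - \<epsilon> * (a * (norm x)\<^sup>2)"
      using below[of x] \<open>0 \<le> \<epsilon>\<close> by (intro diff_left_mono mult_left_mono)
    also have "\<dots> = (sqrt (1 - \<epsilon> * a) * norm x)\<^sup>2"
      using le1 by (simp add: power_mult_distrib algebra_simps)
    finally show "norm (u x) \<le> sqrt (1 - \<epsilon> * a) * norm x"
      by (rule power2_le_imp_le) (simp add: le1)
  qed (simp add: le1)
  then have "norm u * norm u \<le> sqrt (1 - \<epsilon> * a) * sqrt (1 - \<epsilon> * a)"
    by (intro mult_mono) (simp_all add: le1)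
  then show ?thesis
    using norm_blinfun_compose[of u u] le1 by simp
qed

context tracial_von_neumann_algebra
begin

lemma M_eq: "M = commutant (commutant M)"
  using von_neumann_algebra by (simp add: von_neumann_algebra_def)

lemma M_clinear: "A \<in> M \<Longrightarrow> clinear_op A"
  and M_adj: "A \<in> M \<Longrightarrow> adj A \<in> M"
  using von_neumann_algebra by (simp_all add: von_neumann_algebra_def)

lemma M_id: "id_blinfun \<in> M"
  and M_add: "A \<in> M \<Longrightarrow> B \<in> M \<Longrightarrow> A + B \<in> M"
  and M_compose: "A \<in> M \<Longrightarrow> B \<in> M \<Longrightarrow> A o\<^sub>L B \<in> M"
  and closed_M: "closed M"
  using M_eq commutant_id commutant_add commutant_compose closed_commutant by metis+

lemma M_op_scale: "A \<in> M \<Longrightarrow> op_scale c A \<in> M"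
  using M_eq commutant_op_scale[of "commutant M" A c] by (simp add: commutant_def)

lemma M_scaleR: "A \<in> M \<Longrightarrow> a *\<^sub>R A \<in> M"
  by (metis M_op_scale op_scale_of_real)

lemma M_diff: "A \<in> M \<Longrightarrow> B \<in> M \<Longrightarrow> A - B \<in> M"
  using M_add[of A "(-1) *\<^sub>R B"] M_scaleR[of B "-1"] by simp

lemma M_zero: "0 \<in> M"
  using M_scaleR[OF M_id, of 0] by simp

lemma M_sum: "(\<And>i. i \<in> I \<Longrightarrow> f i \<in> M) \<Longrightarrow> sum f I \<in> M"
  by (induction I rule: infinite_finite_induct) (simp_all add: M_zero M_add)

lemma M_op_pow: "A \<in> M \<Longrightarrow> op_pow A n \<in> M"
  by (induction n) (simp_all add: M_id M_compose)

lemmas M_intros = M_id M_add M_diff M_compose M_adj M_op_scale M_scaleR M_sum M_op_pow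

lemma adj_scaleR: "A \<in> M \<Longrightarrow> adj (a *\<^sub>R A) = a *\<^sub>R adj A"
  using adj_op_scale[OF M_clinear, of A "complex_of_real a"] by (simp add: op_scale_of_real)

lemma adj_diff: "A \<in> M \<Longrightarrow> B \<in> M \<Longrightarrow> adj (A - B) = adj A - adj B"
  using adj_add[of A "(-1) *\<^sub>R B"] adj_scaleR[of B "-1"]
  by (simp add: M_clinear M_scaleR[of B "-1", simplified])

lemma adj_op_pow: "A \<in> M \<Longrightarrow> adj (op_pow A n) = op_pow (adj A) n"
  by (induction n)
    (simp_all add: adj_id adj_compose M_clinear M_op_pow op_pow_Suc_right del: op_pow_Suc,
     simp add: op_pow_Suc_right[symmetric])

lemma trace_scaleR: "A \<in> M \<Longrightarrow> \<tau> (a *\<^sub>R A) = complex_of_real a * \<tau> A"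
  by (metis trace_scale op_scale_of_real)

lemma trace_diff: "A \<in> M \<Longrightarrow> B \<in> M \<Longrightarrow> \<tau> (A - B) = \<tau> A - \<tau> B"
  using trace_add[of "A - B" B] by (simp add: M_diff)

lemma trace_zero: "\<tau> 0 = 0"
  using trace_scaleR[OF M_id, of 0] by simp

lemma trace_sum: "(\<And>i. i \<in> I \<Longrightarrow> f i \<in> M) \<Longrightarrow> \<tau> (sum f I) = (\<Sum>i\<in>I. \<tau> (f i))"
  by (induction I rule: infinite_finite_induct) (simp_all add: trace_zero trace_add M_sum)

lemma closed_selfadjoint: "closed {Y \<in> M. adj Y = Y}"
  unfolding closed_sequential_limits
proof (intro allI impI, elim conjE)
  fix Y l
  assume Y: "\<forall>n. Y n \<in> {Y \<in> M. adj Y = Y}" and lim: "Y \<longlonglongrightarrow> l"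
  have l: "l \<in> M"
    using closed_M Y lim unfolding closed_sequential_limits by blast
  have "norm (Y n - adj l) \<le> norm (Y n - l)" for n
    using norm_adj_le[OF M_clinear, of "Y n - l"] Y l by (simp add: adj_diff M_diff)
  moreover have "(\<lambda>n. norm (Y n - l)) \<longlonglongrightarrow> 0"
    using lim by (simp add: tendsto_norm_zero_iff LIM_zero_iff)
  ultimately have "(\<lambda>n. Y n - adj l) \<longlonglongrightarrow> 0"
    by (intro Lim_null_comparison[of "\<lambda>n. Y n - adj l" "\<lambda>n. norm (Y n - l)"]) auto
  then have "Y \<longlonglongrightarrow> adj l"
    by (simp add: LIM_zero_iff)
  from LIMSEQ_unique[OF this lim]
  show "l \<in> {Y \<in> M. adj Y = Y}"
    using l by simp
qed

text \<open>
  Square roots come from the contraction \<open>Y \<mapsto> (x + Y\<^sup>2) / 2\<close>: its fixed point \<open>Y\<close> satisfies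
  \<open>(1 - Y)\<^sup>2 = 1 - x\<close>.
\<close>

lemma ex_selfadjoint_sqrt:
  assumes x: "x \<in> M" "adj x = x" "norm x < 1"
  shows "\<exists>S\<in>M. adj S = S \<and> S o\<^sub>L S = id_blinfun - x"
proof -
  define D where "D = {Y \<in> M. adj Y = Y} \<inter> cball 0 (norm x)"
  define f where "f Y = (1/2) *\<^sub>R (x + (Y o\<^sub>L Y))" for Y
  have D: "Y \<in> D \<longleftrightarrow> Y \<in> M \<and> adj Y = Y \<and> norm Y \<le> norm x" for Y
    by (simp add: D_def)
  have complete: "complete D"
    using closed_selfadjoint by (simp add: D_def complete_eq_closed closed_Int)
  have nonempty: "D \<noteq> {}"
    using x D by blast
  have invariant: "f ` D \<subseteq> D"
  proof
    fix Z assume "Z \<in> f ` D"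
    then obtain Y where Y: "Y \<in> M" "adj Y = Y" "norm Y \<le> norm x" and Z: "Z = f Y"
      using D by blast
    have "norm (Y o\<^sub>L Y) \<le> norm Y * norm Y"
      by (rule norm_blinfun_compose)
    also have "\<dots> \<le> norm x * 1"
      using Y x by (intro mult_mono) auto
    finally have "norm (x + (Y o\<^sub>L Y)) \<le> 2 * norm x"
      using norm_triangle_ineq[of x "Y o\<^sub>L Y"] by simp
    moreover have "adj Z = Z"
      using Y x by (simp add: Z f_def adj_scaleR M_intros adj_add M_clinear adj_compose)
    ultimately show "Z \<in> D"
      using Y x by (simp add: D Z f_def M_intros)
  qed
  have contraction: "dist (f Y) (f Y') \<le> norm x * dist Y Y'" if Y: "Y \<in> D" "Y' \<in> D" for Y Y'
  proof -
    have "(Y o\<^sub>L Y) - (Y' o\<^sub>L Y') = (Y o\<^sub>L (Y - Y')) + ((Y - Y') o\<^sub>L Y')"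
      by (simp add: compose_diff_left compose_diff_right)
    then have "norm ((Y o\<^sub>L Y) - (Y' o\<^sub>L Y')) \<le> norm (Y o\<^sub>L (Y - Y')) + norm ((Y - Y') o\<^sub>L Y')"
      by (simp add: norm_triangle_ineq)
    also have "\<dots> \<le> norm Y * norm (Y - Y') + norm (Y - Y') * norm Y'"
      by (intro add_mono norm_blinfun_compose)
    also have "\<dots> \<le> norm x * norm (Y - Y') + norm (Y - Y') * norm x"
      using Y D by (intro add_mono mult_mono) auto
    finally have "norm ((Y o\<^sub>L Y) - (Y' o\<^sub>L Y')) \<le> 2 * (norm x * norm (Y - Y'))"
      by simp
    moreover have "f Y - f Y' = (1/2) *\<^sub>R ((Y o\<^sub>L Y) - (Y' o\<^sub>L Y'))"
      by (simp add: f_def scaleR_add_right scaleR_diff_right)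
    ultimately show "dist (f Y) (f Y') \<le> norm x * dist Y Y'"
      by (simp add: dist_norm)
  qed
  obtain Y where Y: "Y \<in> M" "adj Y = Y" "f Y = Y"
    using Banach_fix[OF complete nonempty norm_ge_zero x(3) invariant contraction] D by blast
  have "Y + Y = 2 *\<^sub>R f Y"
    by (simp only: Y(3) scaleR_2)
  also have "\<dots> = x + (Y o\<^sub>L Y)"
    by (simp add: f_def)
  finally have "x = Y + Y - (Y o\<^sub>L Y)"
    by (simp only: add_diff_cancel_right')
  then have "(id_blinfun - Y) o\<^sub>L (id_blinfun - Y) = id_blinfun - x"
    by (simp add: compose_diff_left compose_diff_right)
  moreover have "adj (id_blinfun - Y) = id_blinfun - Y"
    using Y by (simp add: adj_diff M_id adj_id)
  ultimately show ?thesis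
    using Y by (intro bexI[of _ "id_blinfun - Y"]) (simp_all add: M_diff M_id)
qed

text \<open>
  For \<open>c > \<parallel>X\<parallel>\<close> the operator \<open>1 - X / c\<close> is a square, so its trace is nonnegative.
\<close>

lemma trace_selfadjoint_le:
  assumes X: "X \<in> M" "adj X = X"
  shows "Im (\<tau> X) = 0" and "Re (\<tau> X) \<le> norm X"
proof -
  have *: "Im (\<tau> X) = 0 \<and> Re (\<tau> X) \<le> c" if c: "norm X < c" for c
  proof -
    have "0 < c"
      using c norm_ge_zero le_less_trans by blast
    obtain S where S: "S \<in> M" "adj S = S" "S o\<^sub>L S = id_blinfun - (1/c) *\<^sub>R X"
      using ex_selfadjoint_sqrt[of "(1/c) *\<^sub>R X"] X c \<open>0 < c\<close>
      by (auto simp: M_scaleR adj_scaleR)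
    have "0 \<le> \<tau> (id_blinfun - (1/c) *\<^sub>R X)"
      using trace_nonneg[OF S(1)] S(2,3) by simp
    then have "0 \<le> 1 - complex_of_real (1/c) * \<tau> X"
      using X by (simp add: trace_diff trace_scaleR M_id M_scaleR trace_id)
    then show ?thesis
      using \<open>0 < c\<close> by (simp add: less_eq_complex_def field_simps)
  qed
  show "Im (\<tau> X) = 0"
    using *[of "norm X + 1"] by simp
  show "Re (\<tau> X) \<le> norm X"
    by (rule dense_ge) (use * in blast)
qed

text \<open>
  Splitting \<open>X\<close> into its self-adjoint parts costs the factor \<open>2\<close>; all that matters below is norm
  continuity.
\<close>

lemma cmod_trace_le:
  assumes X: "X \<in> M"
  shows "cmod (\<tau> X) \<le> 2 * norm X"
proof -
  have sa: "cmod (\<tau> Y) \<le> norm Y" if "Y \<in> M" "adj Y = Y" for Y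
  proof -
    have "Re (\<tau> ((-1) *\<^sub>R Y)) \<le> norm ((-1) *\<^sub>R Y)"
      using that by (intro trace_selfadjoint_le) (simp_all only: M_scaleR adj_scaleR)
    then have "- Re (\<tau> Y) \<le> norm Y"
      using that trace_scaleR[of Y "-1"] by simp
    then show ?thesis
      using trace_selfadjoint_le[OF that] by (simp add: cmod_eq_Re)
  qed
  define a b where "a = X + adj X" and "b = op_scale \<i> (X - adj X)"
  have ab: "a \<in> M" "b \<in> M"
    using X by (simp_all add: a_def b_def M_intros)
  have nadj: "norm (adj X) \<le> norm X"
    by (rule norm_adj_le[OF M_clinear[OF X]])
  have "adj a = a"
    using X by (simp add: a_def adj_add adj_adj M_clinear M_adj add.commute)
  moreover have "adj b = b"
  proof -
    have "adj b = op_scale (- \<i>) (adj X - X)"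
      using X by (simp add: b_def adj_op_scale adj_diff adj_adj M_clinear M_diff M_adj)
    also have "\<dots> = op_scale (- 1) (op_scale \<i> (adj X - X))"
      by (simp add: op_scale_op_scale)
    also have "\<dots> = b"
      using op_scale_of_real[of "-1" "op_scale \<i> (adj X - X)"]
      by (simp add: b_def op_scale_diff_right)
    finally show ?thesis .
  qed
  moreover have "norm a \<le> 2 * norm X" "norm b \<le> 2 * norm X"
    using norm_triangle_ineq[of X "adj X"] norm_triangle_ineq4[of X "adj X"] nadj
    by (simp_all add: a_def b_def norm_op_scale)
  ultimately have "cmod (\<tau> a) \<le> 2 * norm X" "cmod (\<tau> b) \<le> 2 * norm X"
    using sa ab order_trans by blast+
  moreover have "2 * \<tau> X = \<tau> a - \<i> * \<tau> b"
    using X by (simp add: a_def b_def trace_add trace_diff trace_scale M_adj M_diff algebra_simps)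
  then have "2 * cmod (\<tau> X) \<le> cmod (\<tau> a) + cmod (\<tau> b)"
    using norm_triangle_ineq4[of "\<tau> a" "\<i> * \<tau> b"] by (metis norm_mult norm_numeral norm_ii mult_1)
  ultimately show ?thesis
    by simp
qed

lemma tendsto_trace_zero:
  assumes "\<And>n. X n \<in> M" "X \<longlonglongrightarrow> 0"
  shows "(\<lambda>n. Re (\<tau> (X n))) \<longlonglongrightarrow> 0"
proof (rule Lim_null_comparison)
  show "\<forall>\<^sub>F n in sequentially. norm (Re (\<tau> (X n))) \<le> 2 * norm (X n)"
    using order_trans[OF abs_Re_le_cmod cmod_trace_le[OF assms(1)]]
    by (intro always_eventually allI) simp
  have "(\<lambda>n. 2 * norm (X n)) \<longlonglongrightarrow> 2 * norm (0 :: 'a op)"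
    by (intro tendsto_intros assms(2))
  then show "(\<lambda>n. 2 * norm (X n)) \<longlonglongrightarrow> 0"
    by simp
qed

section \<open>Convexity of traces of powers and concavity of the logarithm\<close>

text \<open>
  For fixed \<open>n\<close> the sequence \<open>i \<mapsto> \<tau> (y ^ (n - i) z ^ i)\<close> is convex, even though \<open>y\<close> and \<open>z\<close> need not
  commute: under the trace its second difference is \<open>\<tau> (d y\<^sup>j d z\<^sup>m)\<close> with \<open>d = z - y\<close>, exactly as for
  numbers, and this is \<open>\<tau> (W\<^sup>* W)\<close> for \<open>W = u\<^sup>j d v\<^sup>m\<close>.
\<close>

lemma trace_mixed_power_second_difference:
  assumes u: "u \<in> M" "adj u = u" and v: "v \<in> M" "adj v = v"
    and y: "y = u o\<^sub>L u" and z: "z = v o\<^sub>L v"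
  shows "0 \<le> Re (\<tau> (op_pow y j o\<^sub>L op_pow z (m + 2))) - 2 * Re (\<tau> (op_pow y (j + 1) o\<^sub>L op_pow z (m + 1)))
    + Re (\<tau> (op_pow y (j + 2) o\<^sub>L op_pow z m))"
proof -
  have yz: "y \<in> M" "z \<in> M"
    using u v by (simp_all add: y z M_compose)
  define d where "d = z - y"
  have d: "d \<in> M" "adj d = d"
    using u v yz by (simp_all add: d_def M_diff adj_diff) (simp add: y z adj_compose M_clinear)
  define W where "W = op_pow u j o\<^sub>L (d o\<^sub>L op_pow v m)"
  have W: "W \<in> M"
    using u v d by (simp add: W_def M_intros)
  have ypow: "op_pow y j = op_pow u j o\<^sub>L op_pow u j"
    using op_pow_mult[of u 2 j] op_pow_mult[of u j 2] by (simp add: y numeral_2_eq_2 mult.commute)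
  have zpow: "op_pow z m = op_pow v m o\<^sub>L op_pow v m"
    using op_pow_mult[of v 2 m] op_pow_mult[of v m 2] by (simp add: z numeral_2_eq_2 mult.commute)
  have adjW: "adj W = op_pow v m o\<^sub>L (d o\<^sub>L op_pow u j)"
    using u v d by (simp add: W_def adj_compose M_clinear M_intros adj_op_pow compose_assoc)
  have "adj W o\<^sub>L W = op_pow v m o\<^sub>L (d o\<^sub>L (op_pow y j o\<^sub>L (d o\<^sub>L op_pow v m)))"
    unfolding adjW by (simp add: W_def ypow compose_assoc)
  then have "\<tau> (adj W o\<^sub>L W) = \<tau> (d o\<^sub>L (op_pow y j o\<^sub>L (d o\<^sub>L op_pow z m)))"
    using trace_commute[of "op_pow v m" "d o\<^sub>L (op_pow y j o\<^sub>L (d o\<^sub>L op_pow v m))"] u v d yz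
    by (simp add: M_intros zpow compose_assoc)
  also have "d o\<^sub>L (op_pow y j o\<^sub>L (d o\<^sub>L op_pow z m))
      = ((z o\<^sub>L (op_pow y j o\<^sub>L op_pow z (m + 1))) - (z o\<^sub>L (op_pow y (j + 1) o\<^sub>L op_pow z m)))
        - ((op_pow y (j + 1) o\<^sub>L op_pow z (m + 1)) - (op_pow y (j + 2) o\<^sub>L op_pow z m))"
    by (simp add: d_def compose_diff_left compose_diff_right compose_assoc
        op_pow_Suc_right[of y j, simplified])
      (simp add: compose_assoc[symmetric] op_pow_Suc_right[of y j, simplified])
  also have "\<tau> \<dots> = (\<tau> (op_pow y j o\<^sub>L op_pow z (m + 2)) - \<tau> (op_pow y (j + 1) o\<^sub>L op_pow z (m + 1)))
        - (\<tau> (op_pow y (j + 1) o\<^sub>L op_pow z (m + 1)) - \<tau> (op_pow y (j + 2) o\<^sub>L op_pow z m))"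
  proof -
    have cyc: "\<tau> (z o\<^sub>L (op_pow y i o\<^sub>L op_pow z l)) = \<tau> (op_pow y i o\<^sub>L op_pow z (Suc l))" for i l
      using trace_commute[of z "op_pow y i o\<^sub>L op_pow z l"] yz
      by (simp add: M_intros compose_assoc op_pow_Suc_right del: op_pow_Suc)
    have "op_pow y i o\<^sub>L op_pow z l \<in> M" "z o\<^sub>L (op_pow y i o\<^sub>L op_pow z l) \<in> M" for i l
      using yz by (simp_all add: M_intros)
    then show ?thesis
      by (simp only: trace_diff M_diff cyc) simp
  qed
  finally show ?thesis
    using trace_nonneg[OF W] by (simp add: less_eq_complex_def)
qed

text \<open>
  The graph of \<open>z \<mapsto> \<tau> (z ^ (p + 1))\<close> on positive operators lies above its tangent at \<open>y\<close>: the convex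
  sequence from the preceding lemma runs from \<open>\<tau> (y ^ (p + 1))\<close> to \<open>\<tau> (z ^ (p + 1))\<close>, and its first
  increment is the derivative term.
\<close>

lemma trace_power_convex:
  assumes u: "u \<in> M" "adj u = u" and v: "v \<in> M" "adj v = v"
    and y: "y = u o\<^sub>L u" and z: "z = v o\<^sub>L v"
  shows "Re (\<tau> (op_pow y (Suc p))) + real (Suc p) * Re (\<tau> (op_pow y p o\<^sub>L (z - y)))
    \<le> Re (\<tau> (op_pow z (Suc p)))"
proof -
  define c where "c i = Re (\<tau> (op_pow y (Suc p - i) o\<^sub>L op_pow z i))" for i
  have yz: "y \<in> M" "z \<in> M"
    using u v by (simp_all add: y z M_compose)
  have "c 0 + real (Suc p) * (c 1 - c 0) \<le> c (Suc p)"
  proof (rule convex_seq_above_tangent[where n = "Suc p"])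
    fix i assume i: "i + 2 \<le> Suc p"
    define j where "j = Suc p - (i + 2)"
    have "Suc p - i = j + 2" "Suc p - (i + 1) = j + 1" "Suc p - (i + 2) = j"
      using i by (simp_all add: j_def)
    then show "0 \<le> c (i + 2) - 2 * c (i + 1) + c i"
      using trace_mixed_power_second_difference[OF u v y z, of j i] by (simp only: c_def)
  qed simp
  moreover have "c 1 - c 0 = Re (\<tau> (op_pow y p o\<^sub>L (z - y)))"
    using yz by (simp add: c_def compose_diff_right trace_diff M_intros op_pow_Suc_right
        del: op_pow_Suc)
  ultimately show ?thesis
    by (simp add: c_def)
qed

text \<open>
  The sums are truncations of \<open>- \<tau> (log (1 - y))\<close>, and \<open>\<Sum>m<N. y\<^sup>m\<close> approximates \<open>1 / (1 - y)\<close>. In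
  the limit, with \<open>K = 1 - y\<close> and \<open>H = 1 - z\<close>, this is Klein's inequality
  \<open>\<tau> (log H) - \<tau> (log K) \<le> \<tau> (inverse K H) - 1\<close>. Staying with finite sums makes it unnecessary to construct
  logarithms of operators.
\<close>

lemma trace_log_series_convex:
  assumes u: "u \<in> M" "adj u = u" and v: "v \<in> M" "adj v = v"
    and y: "y = u o\<^sub>L u" and z: "z = v o\<^sub>L v"
  shows "(\<Sum>m<N. Re (\<tau> (op_pow y (Suc m))) / real (Suc m)) + Re (\<tau> ((\<Sum>m<N. op_pow y m) o\<^sub>L (z - y)))
    \<le> (\<Sum>m<N. Re (\<tau> (op_pow z (Suc m))) / real (Suc m))"
proof -
  have yz: "y \<in> M" "z \<in> M"
    using u v by (simp_all add: y z M_compose)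
  have "Re (\<tau> ((\<Sum>m<N. op_pow y m) o\<^sub>L (z - y))) = (\<Sum>m<N. Re (\<tau> (op_pow y m o\<^sub>L (z - y))))"
    using yz by (simp add: compose_sum_left trace_sum M_intros)
  moreover have "Re (\<tau> (op_pow y (Suc m))) / real (Suc m) + Re (\<tau> (op_pow y m o\<^sub>L (z - y)))
      \<le> Re (\<tau> (op_pow z (Suc m))) / real (Suc m)" for m
    using divide_right_mono[OF trace_power_convex[OF u v y z, of m], of "real (Suc m)"]
    by (simp add: add_divide_distrib del: op_pow_Suc of_nat_Suc)
  ultimately show ?thesis
    by (simp only: sum.distrib[symmetric]) (rule sum_mono, blast)
qed

text \<open>
  Put \<open>K j = (A\<^sup>j)\<^sup>* A\<^sup>j\<close>. By the trace property \<open>\<tau> (inverse (K j) K (j + 1))\<close> does not depend on \<open>j\<close>; it is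
  \<open>t = \<tau> (A\<^sup>* A)\<close>. Adding up Klein's inequalities along \<open>1 = K 0, \<dots>, K n\<close> gives
  \<open>\<tau> (log (K n)) \<le> n (t - 1)\<close>, while the norm bound on the inverse of \<open>A\<^sup>n\<close> means \<open>K n \<ge> 1\<close> and makes
  the left-hand side nonnegative.
\<close>

lemma trace_gram_ge_1:
  assumes A: "A \<in> M" "A' \<in> M" "A o\<^sub>L A' = id_blinfun" "A' o\<^sub>L A = id_blinfun"
    and n: "0 < n" "norm (op_pow A' n) \<le> 1"
  shows "1 \<le> Re (\<tau> (adj A o\<^sub>L A))"
proof -
  define P where "P j = op_pow A j" for j
  define P' where "P' j = op_pow A' j" for j
  have P: "P j \<in> M" "P' j \<in> M" "clinear_op (P j)" "clinear_op (P' j)" for j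
    using A by (simp_all add: P_def P'_def M_op_pow M_clinear)
  have inv: "P j o\<^sub>L P' j = id_blinfun" "P' j o\<^sub>L P j = id_blinfun" for j
    using A by (simp_all add: P_def P'_def op_pow_inverse)
  have adj_inv: "adj (P j) o\<^sub>L adj (P' j) = id_blinfun" "adj (P' j) o\<^sub>L adj (P j) = id_blinfun" for j
    using P inv by (simp_all add: adj_compose[symmetric] adj_id)
  define K where "K j = adj (P j) o\<^sub>L P j" for j
  define G where "G j = P' j o\<^sub>L adj (P' j)" for j
  have KG: "K j \<in> M" "G j \<in> M" for j
    using P by (simp_all add: K_def G_def M_intros)
  have adjK: "adj (K j) = K j" for j
    using P by (simp add: K_def adj_compose clinear_op_adj adj_adj)
  have "K j o\<^sub>L G j = adj (P j) o\<^sub>L ((P j o\<^sub>L P' j) o\<^sub>L adj (P' j))"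
    "G j o\<^sub>L K j = P' j o\<^sub>L ((adj (P' j) o\<^sub>L adj (P j)) o\<^sub>L P j)" for j
    by (simp_all only: K_def G_def compose_assoc)
  then have KG_inv: "K j o\<^sub>L G j = id_blinfun" "G j o\<^sub>L K j = id_blinfun" for j
    by (simp_all add: inv adj_inv)
  define t where "t = Re (\<tau> (adj A o\<^sub>L A))"
  have ratio: "\<tau> (G j o\<^sub>L K (Suc j)) = \<tau> (adj A o\<^sub>L A)" for j
  proof -
    have "adj (P (Suc j)) = adj (P j) o\<^sub>L adj A"
      using P A by (simp add: P_def adj_compose M_clinear)
    then have "G j o\<^sub>L K (Suc j) = P' j o\<^sub>L (((adj (P' j) o\<^sub>L adj (P j)) o\<^sub>L adj A) o\<^sub>L P (Suc j))"
      by (simp only: G_def K_def compose_assoc)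
    also have "\<dots> = P' j o\<^sub>L (adj A o\<^sub>L P (Suc j))"
      by (simp add: adj_inv)
    finally have "\<tau> (G j o\<^sub>L K (Suc j)) = \<tau> ((adj A o\<^sub>L P (Suc j)) o\<^sub>L P' j)"
      using trace_commute[of "P' j" "adj A o\<^sub>L P (Suc j)"] P A by (simp add: M_intros)
    also have "(adj A o\<^sub>L P (Suc j)) o\<^sub>L P' j = adj A o\<^sub>L (A o\<^sub>L (P j o\<^sub>L P' j))"
      by (simp add: P_def compose_assoc)
    finally show ?thesis
      by (simp add: inv)
  qed
  \<comment> \<open>One scaling factor brings all \<open>K j\<close> into the unit ball, where \<open>1 - \<epsilon> K j\<close> has a square root and
    the logarithmic series converges.\<close>
  define \<epsilon> where "\<epsilon> = 1 / (1 + (\<Sum>j\<le>n. norm (K j)))"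
  have sum_nonneg: "0 \<le> (\<Sum>j\<le>n. norm (K j))"
    by (intro sum_nonneg) simp
  then have \<epsilon>: "0 < \<epsilon>" "\<epsilon> \<le> 1"
    by (simp_all add: \<epsilon>_def)
  define y where "y j = id_blinfun - \<epsilon> *\<^sub>R K j" for j
  have yM: "y j \<in> M" for j
    using KG by (simp add: y_def M_intros)
  have "\<exists>u\<in>M. adj u = u \<and> u o\<^sub>L u = y j" if "j \<le> n" for j
  proof -
    have "norm (K j) \<le> (\<Sum>j\<le>n. norm (K j))"
      using that by (intro member_le_sum) auto
    then have "norm (\<epsilon> *\<^sub>R K j) < 1"
      using sum_nonneg by (simp add: \<epsilon>_def)
    then show ?thesis
      unfolding y_def using KG adjK by (intro ex_selfadjoint_sqrt) (simp_all add: M_scaleR adj_scaleR)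
  qed
  then obtain u where u: "\<And>j. j \<le> n \<Longrightarrow> u j \<in> M \<and> adj (u j) = u j \<and> u j o\<^sub>L u j = y j"
    by metis
  \<comment> \<open>The bound \<open>b = 1\<close> is available for \<open>j = n\<close> and gives the comparison with \<open>y 0 = 1 - \<epsilon>\<close>; for the
    other \<open>j\<close> any \<open>b\<close> serves, as only \<open>\<parallel>y j\<parallel> < 1\<close> matters.\<close>
  have norm_y: "norm (y j) \<le> 1 - \<epsilon> * (1 / b\<^sup>2)" if "j \<le> n" "norm (P' j) \<le> b" "1 \<le> b" for j b
  proof -
    have "1 / b\<^sup>2 * (norm x)\<^sup>2 \<le> (norm (P j x))\<^sup>2" for x
    proof -
      have "norm x = norm (P' j (P j x))"
        using arg_cong[OF inv(2)[of j], of "\<lambda>B. blinfun_apply B x"] by simp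
      also have "\<dots> \<le> norm (P' j) * norm (P j x)"
        by (rule norm_blinfun)
      also have "\<dots> \<le> b * norm (P j x)"
        using that by (intro mult_right_mono) auto
      finally have "(norm x)\<^sup>2 \<le> (b * norm (P j x))\<^sup>2"
        by (intro power_mono) auto
      then show ?thesis
        using that by (simp add: power_mult_distrib field_simps)
    qed
    moreover have "1 / b\<^sup>2 \<le> 1"
      using that by simp
    moreover have "u j o\<^sub>L u j = id_blinfun - \<epsilon> *\<^sub>R (adj (P j) o\<^sub>L P j)"
      using u[OF that(1)] by (simp add: y_def K_def)
    ultimately have "norm (u j o\<^sub>L u j) \<le> 1 - \<epsilon> * (1 / b\<^sup>2)"
      using u[OF that(1)] P \<epsilon> by (intro norm_square_le[where P = "P j"]) (simp_all add: M_clinear)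
    then show ?thesis
      using u[OF that(1)] by simp
  qed
  have y_pow_null: "(\<lambda>N. op_pow (y j) N) \<longlonglongrightarrow> 0" if "j \<le> n" for j
  proof (rule Lim_null_comparison)
    show "\<forall>\<^sub>F N in sequentially. norm (op_pow (y j) N) \<le> norm (y j) ^ N"
      by (simp add: norm_op_pow_le)
    have "norm (y j) < 1"
      using norm_y[OF that, of "1 + norm (P' j)"] \<epsilon> by (smt (verit) norm_ge_zero mult_pos_pos divide_pos_pos zero_less_power)
    then show "(\<lambda>N. norm (y j) ^ N) \<longlonglongrightarrow> 0"
      by (intro LIMSEQ_power_zero) simp
  qed
  \<comment> \<open>\<open>W j\<close> is the limit, as \<open>N\<close> grows, of the tangent term in the step from \<open>y j\<close> to \<open>y (j + 1)\<close>.\<close>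
  define W where "W j = id_blinfun - (G j o\<^sub>L K (Suc j))" for j
  have WM: "W j \<in> M" for j
    using KG by (simp add: W_def M_intros)
  have traceW: "Re (\<tau> (W j)) = 1 - t" for j
    using KG by (simp add: W_def trace_diff M_intros trace_id ratio t_def)
  have tangent: "(\<Sum>m<N. op_pow (y j) m) o\<^sub>L (y (Suc j) - y j) = W j - (op_pow (y j) N o\<^sub>L W j)" for j N
  proof -
    have "(\<Sum>m<N. op_pow (y j) m) o\<^sub>L (\<epsilon> *\<^sub>R K j) = id_blinfun - op_pow (y j) N"
      using op_geometric_sum(1)[of "y j" N] by (simp add: y_def)
    moreover have "y (Suc j) - y j = (\<epsilon> *\<^sub>R K j) o\<^sub>L W j"
      by (simp add: y_def W_def compose_diff_right compose_scaleR_left compose_assoc[symmetric]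
          KG_inv scaleR_diff_right)
    ultimately show ?thesis
      by (simp add: compose_assoc[symmetric] compose_diff_left)
  qed
  define S where "S N j = (\<Sum>m<N. Re (\<tau> (op_pow (y j) (Suc m))) / real (Suc m))" for N j
  have step: "S N j + (1 - t) - Re (\<tau> (op_pow (y j) N o\<^sub>L W j)) \<le> S N (Suc j)" if "j < n" for N j
  proof -
    have "S N j + Re (\<tau> (W j - (op_pow (y j) N o\<^sub>L W j))) \<le> S N (Suc j)"
      unfolding S_def tangent[symmetric]
      using u[of j] u[of "Suc j"] that by (intro trace_log_series_convex[of "u j" "u (Suc j)"]) auto
    then show ?thesis
      using WM yM by (simp add: trace_diff M_intros traceW)
  qed
  have chain: "S N 0 + real i * (1 - t) - (\<Sum>j<i. Re (\<tau> (op_pow (y j) N o\<^sub>L W j))) \<le> S N i"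
    if "i \<le> n" for N i
    using that
  proof (induction i)
    case (Suc i)
    then show ?case
      using step[of i N] by (simp add: algebra_simps)
  qed simp
  have last: "S N n \<le> S N 0" for N
    unfolding S_def
  proof (intro sum_mono divide_right_mono)
    fix m
    have y0: "y 0 = (1 - \<epsilon>) *\<^sub>R id_blinfun"
      by (simp add: y_def K_def P_def adj_id scaleR_diff_left)
    have "op_pow (id_blinfun :: 'a op) i = id_blinfun" for i
      by (induction i) simp_all
    then have "\<tau> (op_pow (y 0) (Suc m)) = complex_of_real ((1 - \<epsilon>) ^ Suc m)"
      by (simp only: y0 op_pow_scaleR trace_scaleR[OF M_id] trace_id mult_1_right)
    moreover have "Re (\<tau> (op_pow (y n) (Suc m))) \<le> norm (op_pow (y n) (Suc m))"
    proof (rule trace_selfadjoint_le)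
      have "adj (y n) = y n"
        using KG adjK by (simp add: y_def adj_diff M_intros adj_id adj_scaleR)
      then show "adj (op_pow (y n) (Suc m)) = op_pow (y n) (Suc m)"
        using yM by (simp add: adj_op_pow del: op_pow_Suc)
    qed (use yM M_op_pow in blast)
    moreover have "norm (op_pow (y n) (Suc m)) \<le> norm (y n) ^ Suc m"
      by (rule norm_op_pow_le)
    moreover have "norm (y n) \<le> 1 - \<epsilon>"
      using norm_y[of n 1] n by (simp add: P'_def)
    then have "norm (y n) ^ Suc m \<le> (1 - \<epsilon>) ^ Suc m"
      by (intro power_mono) auto
    ultimately show "Re (\<tau> (op_pow (y n) (Suc m))) \<le> Re (\<tau> (op_pow (y 0) (Suc m)))"
      by (simp del: op_pow_Suc power_Suc)
  qed simp
  have "(\<lambda>N. \<Sum>j<n. Re (\<tau> (op_pow (y j) N o\<^sub>L W j))) \<longlonglongrightarrow> (\<Sum>j<n. 0)"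
  proof (intro tendsto_sum tendsto_trace_zero)
    fix j assume "j \<in> {..<n}"
    then have "(\<lambda>N. op_pow (y j) N o\<^sub>L W j) \<longlonglongrightarrow> (0 o\<^sub>L W j)"
      by (intro bounded_bilinear.tendsto[OF bounded_bilinear_blinfun_compose] y_pow_null tendsto_const) simp
    then show "(\<lambda>N. op_pow (y j) N o\<^sub>L W j) \<longlonglongrightarrow> 0"
      by (simp add: bounded_bilinear.zero_left[OF bounded_bilinear_blinfun_compose])
  qed (use yM WM in \<open>simp add: M_intros\<close>)
  moreover have "real n * (1 - t) \<le> (\<Sum>j<n. Re (\<tau> (op_pow (y j) N o\<^sub>L W j)))" for N
    using chain[of n N] last[of N] by simp
  ultimately have "real n * (1 - t) \<le> (\<Sum>j<n. 0)"
    by (intro LIMSEQ_le_const) auto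
  then show ?thesis
    using n by (simp add: t_def mult_le_0_iff)
qed

section \<open>Spectral bounds for the two-norm of powers\<close>

text \<open>
  For \<open>\<rho> < r\<close> the operator \<open>A = (Z / \<rho>)\<^sup>k\<close> satisfies the hypotheses of \<open>trace_gram_ge_1\<close> for large
  exponents; then \<open>\<rho>\<close> tends to \<open>r\<close>.
\<close>

lemma trace_gram_power_ge:
  assumes Z: "Z \<in> M" "Z' \<in> M" "Z o\<^sub>L Z' = id_blinfun" "Z' o\<^sub>L Z = id_blinfun"
    and decay: "\<And>\<rho>. 0 < \<rho> \<Longrightarrow> \<rho> < r \<Longrightarrow> (\<lambda>n. \<rho> ^ n * norm (op_pow Z' n)) \<longlonglongrightarrow> 0"
    and "0 < r" "0 < k"
  shows "complex_of_real (r ^ (2 * k)) \<le> \<tau> (adj (op_pow Z k) o\<^sub>L op_pow Z k)"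
proof -
  define T where "T = \<tau> (adj (op_pow Z k) o\<^sub>L op_pow Z k)"
  have below: "\<rho> ^ (2 * k) \<le> Re T" if \<rho>: "0 < \<rho>" "\<rho> < r" for \<rho>
  proof -
    define A where "A = (1 / \<rho> ^ k) *\<^sub>R op_pow Z k"
    define A' where "A' = \<rho> ^ k *\<^sub>R op_pow Z' k"
    have A: "A \<in> M" "A' \<in> M" "A o\<^sub>L A' = id_blinfun" "A' o\<^sub>L A = id_blinfun"
      using Z \<rho> by (simp_all add: A_def A'_def M_intros compose_scaleR_left compose_scaleR_right
          op_pow_inverse)
    have "\<forall>\<^sub>F n in sequentially. \<rho> ^ n * norm (op_pow Z' n) < 1"
      using decay[OF \<rho>] by (rule order_tendstoD) simp
    then obtain N where N: "\<And>n. N \<le> n \<Longrightarrow> \<rho> ^ n * norm (op_pow Z' n) < 1"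
      by (auto simp: eventually_sequentially)
    have "N \<le> k * Suc N"
      using \<open>0 < k\<close> mult_le_mono1[of 1 k "Suc N"] by simp
    have "norm (op_pow A' (Suc N)) = \<rho> ^ (k * Suc N) * norm (op_pow Z' (k * Suc N))"
      using \<rho> by (simp only: A'_def op_pow_scaleR power_mult[symmetric] op_pow_mult[symmetric])
        (simp add: abs_of_nonneg del: op_pow_Suc mult_Suc_right)
    then have "norm (op_pow A' (Suc N)) \<le> 1"
      using N[OF \<open>N \<le> k * Suc N\<close>] by linarith
    then have "1 \<le> Re (\<tau> (adj A o\<^sub>L A))"
      by (intro trace_gram_ge_1[OF A]) auto
    also have "adj A o\<^sub>L A = (1 / \<rho> ^ (2 * k)) *\<^sub>R (adj (op_pow Z k) o\<^sub>L op_pow Z k)"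
      using Z by (simp add: A_def adj_scaleR M_op_pow compose_scaleR_left compose_scaleR_right
          mult_2 power_add)
    also have "Re (\<tau> \<dots>) = Re T / \<rho> ^ (2 * k)"
      using Z by (simp add: T_def trace_scaleR M_intros del: of_real_divide)
    finally show ?thesis
      using \<rho> by (simp add: field_simps)
  qed
  have "((\<lambda>\<rho>. \<rho> ^ (2 * k)) \<longlongrightarrow> r ^ (2 * k)) (at_left r)"
    by (intro tendsto_intros)
  moreover have "\<forall>\<^sub>F \<rho> in at_left r. \<rho> ^ (2 * k) \<le> Re T"
    using below \<open>0 < r\<close> by (intro eventually_at_leftI[of 0]) auto
  ultimately have "r ^ (2 * k) \<le> Re T"
    by (rule tendsto_upperbound) simp
  moreover have "0 \<le> T"
    unfolding T_def using Z by (intro trace_nonneg M_op_pow)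
  ultimately show ?thesis
    by (simp add: T_def less_eq_complex_def)
qed

lemma power_decay_spectrum_le:
  assumes Z: "Z \<in> M" and spectrum: "spectrum_in M Z \<subseteq> {z. cmod z \<le> s}"
    and "0 < s" "0 < \<rho>" "\<rho> < 1 / s"
  shows "(\<lambda>n. \<rho> ^ n * norm (op_pow Z n)) \<longlonglongrightarrow> 0"
proof -
  obtain R where R: "\<rho> < R" "R < 1 / s"
    using dense assms by blast
  have "\<exists>F. F o\<^sub>L (id_blinfun - op_scale z Z) = id_blinfun
      \<and> (id_blinfun - op_scale z Z) o\<^sub>L F = id_blinfun" if z: "cmod z \<le> R" for z
  proof (cases "z = 0")
    case True
    then show ?thesis
      using op_scale_of_real[of 0 Z] by (intro exI[of _ id_blinfun]) simp
  next
    case False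
    have "cmod z < 1 / s"
      using z R by simp
    then have "s < cmod (1 / z)"
      using False \<open>0 < s\<close> by (simp add: norm_divide field_simps)
    then have "1 / z \<notin> spectrum_in M Z"
      using spectrum by force
    then obtain B where B: "B \<in> M" "(Z - op_scale (1 / z) id_blinfun) o\<^sub>L B = id_blinfun"
      "B o\<^sub>L (Z - op_scale (1 / z) id_blinfun) = id_blinfun"
      by (auto simp: spectrum_in_def)
    have one: "op_scale 1 A = A" for A :: "'a op"
      using op_scale_of_real[of 1 A] by simp
    have "id_blinfun - op_scale z Z = op_scale (- z) (Z - op_scale (1 / z) id_blinfun)"
      using False one op_scale_diff_left[of 0 z Z] op_scale_of_real[of 0 Z]
        op_scale_of_real[of "-1" "id_blinfun :: 'a op"]
      by (simp add: op_scale_diff_right op_scale_op_scale)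
    then show ?thesis
      using B False one
      by (intro exI[of _ "op_scale (- (1 / z)) B"])
        (simp add: compose_op_scale_left compose_op_scale_right M_clinear M_intros Z op_scale_op_scale)
  qed
  then obtain F where "\<And>z. cmod z \<le> R \<Longrightarrow> F z o\<^sub>L (id_blinfun - op_scale z Z) = id_blinfun"
    and "\<And>z. cmod z \<le> R \<Longrightarrow> (id_blinfun - op_scale z Z) o\<^sub>L F z = id_blinfun"
    by metis
  then interpret resolvent_on_disc Z R F
    using Z R assms by unfold_locales (simp_all add: M_clinear)
  show ?thesis
    using R assms by (intro power_decay) auto
qed

lemma power_decay_spectrum_ge:
  assumes Z: "Z \<in> M" "Z' \<in> M" "Z o\<^sub>L Z' = id_blinfun" "Z' o\<^sub>L Z = id_blinfun"
    and spectrum: "spectrum_in M Z \<subseteq> {z. r \<le> cmod z}" and "0 < \<rho>" "\<rho> < r"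
  shows "(\<lambda>n. \<rho> ^ n * norm (op_pow Z' n)) \<longlonglongrightarrow> 0"
proof -
  obtain R where R: "\<rho> < R" "R < r"
    using dense assms by blast
  have "\<exists>F. F o\<^sub>L (id_blinfun - op_scale z Z') = id_blinfun
      \<and> (id_blinfun - op_scale z Z') o\<^sub>L F = id_blinfun" if z: "cmod z \<le> R" for z
  proof -
    have "z \<notin> spectrum_in M Z"
      using spectrum z R by force
    then obtain B where B: "B \<in> M" "(Z - op_scale z id_blinfun) o\<^sub>L B = id_blinfun"
      "B o\<^sub>L (Z - op_scale z id_blinfun) = id_blinfun"
      by (auto simp: spectrum_in_def)
    have "id_blinfun - op_scale z Z' = (Z - op_scale z id_blinfun) o\<^sub>L Z'"
      using Z by (simp add: compose_diff_left compose_op_scale_left)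
    then have "(Z o\<^sub>L B) o\<^sub>L (id_blinfun - op_scale z Z')
        = Z o\<^sub>L ((B o\<^sub>L (Z - op_scale z id_blinfun)) o\<^sub>L Z')"
      by (simp only: compose_assoc)
    moreover have "(id_blinfun - op_scale z Z') o\<^sub>L (Z o\<^sub>L B) = (Z - op_scale z id_blinfun) o\<^sub>L B"
      using Z by (simp add: compose_diff_left compose_op_scale_left)
        (simp add: compose_assoc[symmetric])
    ultimately show ?thesis
      using B Z by (intro exI[of _ "Z o\<^sub>L B"]) simp
  qed
  then obtain F where "\<And>z. cmod z \<le> R \<Longrightarrow> F z o\<^sub>L (id_blinfun - op_scale z Z') = id_blinfun"
    and "\<And>z. cmod z \<le> R \<Longrightarrow> (id_blinfun - op_scale z Z') o\<^sub>L F z = id_blinfun"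
    by metis
  then interpret resolvent_on_disc Z' R F
    using Z R assms by unfold_locales (simp_all add: M_clinear)
  show ?thesis
    using R assms by (intro power_decay) auto
qed

end

theorem corollary5p5:
  fixes M\<^sub>0 :: "'b :: complex_hilbert_space op set" and \<tau>\<^sub>0 :: "'b op \<Rightarrow> complex"
    and lam :: "(real \<Rightarrow> complex) \<Rightarrow> 'b op" and X :: "'b op"
    and M :: "'a :: complex_hilbert_space op set" and \<tau> :: "'a op \<Rightarrow> complex"
    and Z :: "'a op" and r s :: real and k :: nat
  assumes "DT_setup M\<^sub>0 \<tau>\<^sub>0 lam X"
    and "0 < r" and "r < s"
    and "tracial_von_neumann_algebra M \<tau>"
    and "Z \<in> M"
    and "is_DT_operator \<tau>\<^sub>0 lam X \<tau> Z"
    and "spectrum_in M Z \<subseteq> {z. r \<le> cmod z \<and> cmod z \<le> s}"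
    and "k \<ge> 1"
  shows "\<tau> (adj (op_pow Z k) o\<^sub>L op_pow Z k) \<ge> complex_of_real (r ^ (2 * k)) \<and>
         \<tau> (adj (op_pow (op_inverse Z) k) o\<^sub>L op_pow (op_inverse Z) k)
           \<ge> complex_of_real (s powi (- (2 * int k)))"
proof -
  interpret tracial_von_neumann_algebra M \<tau>
    by fact
  have "0 \<notin> spectrum_in M Z"
    using assms(2,7) by force
  then obtain Z' where Z': "Z' \<in> M" "Z o\<^sub>L Z' = id_blinfun" "Z' o\<^sub>L Z = id_blinfun"
    using op_scale_of_real[of 0 "id_blinfun :: 'a op"] by (auto simp: spectrum_in_def)
  have "op_inverse Z = Z'"
    unfolding op_inverse_def
  proof (rule the_equality)
    show "B = Z'" if "Z o\<^sub>L B = id_blinfun \<and> B o\<^sub>L Z = id_blinfun" for B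
      using that Z' compose_assoc[of B Z Z'] by simp
  qed (use Z' in simp)
  have "0 < s" "0 < k"
    using assms by simp_all
  have "complex_of_real (r ^ (2 * k)) \<le> \<tau> (adj (op_pow Z k) o\<^sub>L op_pow Z k)"
    using assms Z' \<open>0 < k\<close>
    by (intro trace_gram_power_ge[of Z Z'] power_decay_spectrum_ge[of Z Z' r]) auto
  moreover have "complex_of_real ((1 / s) ^ (2 * k)) \<le> \<tau> (adj (op_pow Z' k) o\<^sub>L op_pow Z' k)"
    using assms Z' \<open>0 < k\<close> \<open>0 < s\<close>
    by (intro trace_gram_power_ge[of Z' Z] power_decay_spectrum_le[of Z s]) auto
  moreover have "s powi (- (2 * int k)) = (1 / s) ^ (2 * k)"
    using power_int_of_nat[of s "2 * k"] by (simp add: power_int_minus power_one_over field_simps)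
  ultimately show ?thesis
    by (simp only: \<open>op_inverse Z = Z'\<close>)
qed

end
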